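(* Let $S=\{a_n\}_{n\in\mathbb N}$ be a sequence of complex numbers satisfying (i)–(iii) of the context, with exponent of convergence $\alpha$ and ray angle $\Psi$, and let $F$ be a characteristic function of $S$ of minimal growth order, i.e. an entire function with zeros exactly at the sequence $S$ (counting multiplicity) of the form $F=e^{\omega}H$ with $\omega$ a polynomial of degree at most $\lfloor\alpha\rfloor$ and $H$ the Hadamard product of the context. For $0<R<|a_1|$ let $C_R$ be the circle of radius $R$ parametrized by $z=Re^{i\theta}$ from $\theta=\Psi-2\pi$ to $\theta=\Psi$. Then $$\zeta_S(s)=e^{is(\pi-\Psi)}\frac{\sin(\pi s)}{\pi}\int_R^\infty dt\,t^{-s}\frac{d}{dt}\ln F(te^{i\Psi})-\frac{1}{2\pi i}\int_{C_R}dz\,z^{-s}\frac{d}{dz}\ln F(z),\qquad \Re(s)>\alpha .$$ Moreover, if $\alpha<1$, then $$\zeta_S(s)=e^{is(\pi-\Psi)}\frac{\sin(\pi s)}{\pi}\int_0^\infty dt\,t^{-s}\frac{d}{dt}\ln F(te^{i\Psi}),\qquad \alpha<\Re(s)<1 .$$ If $F$ is further assumed to be given by the Hadamard product, $F=H$, then $$\zeta_S(s)=e^{is(\pi-\Psi)}\frac{\sin(\pi s)}{\pi}\int_0^\infty dt\,t^{-s}\frac{d}{dt}\ln F(te^{i\Psi}),\qquad \alpha<\Re(s)<\lfloor\alpha\rfloor+1 .$$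
   Context: Assumptions on $S=\{a_n\}_{n\in\mathbb N}\subset\mathbb C$: (i) $0<|a_1|\le|a_2|\le\dots\to\infty$; (ii) $\alpha=\limsup_{n\to\infty}(\ln n)/(\ln|a_n|)$ is finite; (iii) there exist $\varepsilon>0$ and $\Psi\in[-\pi,\pi)$ such that all $a_n\in\mathcal I_\varepsilon=\{z\in\mathbb C:\operatorname{Arg}(z)\notin(\Psi-\varepsilon,\Psi+\varepsilon)\}$ (arguments modulo $2\pi$). The $\zeta$-function is $\zeta_S(s)=\sum_{n=1}^\infty a_n^{-s}$ for $\Re(s)>\alpha$, with branch cut along the ray $R_\Psi=\{te^{i\Psi}:t\ge0\}$: $z^{-s}=\exp(-s(\ln|z|+i\theta))$ where $\theta\in(\Psi-2\pi,\Psi)$ is the argument of $z$. The Hadamard product is, with $k=\lfloor\alpha\rfloor+1$, $$H(z)=\prod_{n=1}^{\infty}\left(1-\frac{z}{a_n}\right)\exp\left[\sum_{j=1}^{k-1}\frac1j\left(\frac{z}{a_n}\right)^j\right].$$ Logarithmic derivatives $\frac{d}{dz}\ln F$ mean $F'/F$. *)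

theory Defs
  imports "HOL-Complex_Analysis.Complex_Analysis" "HOL-Complex_Analysis.Weierstrass_Factorization"
begin

text \<open>
  A sequence \<open>S = (a\<^sub>n)\<close> indexed by \<open>n \<ge> 1\<close> is a function \<open>a :: nat \<Rightarrow> complex\<close> whose value
  at \<open>0\<close> is ignored.
\<close>

definition exponent_of_convergence :: "(nat \<Rightarrow> complex) \<Rightarrow> ereal" where
  "exponent_of_convergence a = limsup (\<lambda>n. ereal (ln (real n) / ln (norm (a n))))"

text \<open>The condition is imposed on every value of the argument, i.e. modulo \<open>2\<pi>\<close>.\<close>

definition sector_complement :: "real \<Rightarrow> real \<Rightarrow> complex set" where
  "sector_complement \<Psi> \<epsilon> =
     {z. \<forall>m::int. Arg z + 2 * pi * of_int m \<notin> {\<Psi> - \<epsilon> <..< \<Psi> + \<epsilon>}}"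

text \<open>
  Argument and powers with branch cut along the ray at angle \<open>\<Psi>\<close>. Off the cut the argument lies
  in \<open>(\<Psi> - 2\<pi>, \<Psi>)\<close>; on the cut, where the branch is not defined mathematically, it is assigned
  the value \<open>\<Psi>\<close>. Only \<open>z \<noteq> 0\<close> is meaningful.
\<close>

definition branch_arg :: "real \<Rightarrow> complex \<Rightarrow> real" where
  "branch_arg \<Psi> z =
     (THE \<theta>. \<Psi> - 2 * pi < \<theta> \<and> \<theta> \<le> \<Psi> \<and> z = of_real (norm z) * cis \<theta>)"

definition branch_powr :: "real \<Rightarrow> complex \<Rightarrow> complex \<Rightarrow> complex" where
  "branch_powr \<Psi> z w =
     exp (w * (of_real (ln (norm z)) + \<i> * of_real (branch_arg \<Psi> z)))"

definition zeta_seq :: "(nat \<Rightarrow> complex) \<Rightarrow> real \<Rightarrow> complex \<Rightarrow> complex" where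
  "zeta_seq a \<Psi> s = (\<Sum>n. branch_powr \<Psi> (a (Suc n)) (- s))"

definition hadamard_product :: "(nat \<Rightarrow> complex) \<Rightarrow> nat \<Rightarrow> complex \<Rightarrow> complex" where
  "hadamard_product a k z = (\<Prod>n. weierstrass_factor (k - 1) (z / a (Suc n)))"

definition minimal_characteristic_function ::
    "(nat \<Rightarrow> complex) \<Rightarrow> real \<Rightarrow> (complex \<Rightarrow> complex) \<Rightarrow> bool" where
  "minimal_characteristic_function a \<alpha> F \<longleftrightarrow>
     F holomorphic_on UNIV \<and>
     {z. F z = 0} = a ` {1..} \<and>
     (\<forall>n\<ge>1. zorder F (a n) = int (card {m. 1 \<le> m \<and> a m = a n})) \<and>
     (\<exists>\<omega> :: complex poly. degree \<omega> \<le> nat \<lfloor>\<alpha>\<rfloor> \<and>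
        (\<forall>z. F z = exp (poly \<omega> z) * hadamard_product a (nat \<lfloor>\<alpha>\<rfloor> + 1) z))"

text \<open>\<open>t\<^sup>-\<^sup>s d/dt ln F(t e\<^sup>i\<^sup>\<Psi>)\<close> for \<open>t > 0\<close>; the power is the ordinary one, since \<open>t\<close> is
  a positive real number.\<close>

definition ray_integrand ::
    "(complex \<Rightarrow> complex) \<Rightarrow> real \<Rightarrow> complex \<Rightarrow> real \<Rightarrow> complex" where
  "ray_integrand F \<Psi> s t =
     of_real t powr (- s) *
     (vector_derivative (\<lambda>u. F (of_real u * cis \<Psi>)) (at t) / F (of_real t * cis \<Psi>))"

definition circle_integrand ::
    "(complex \<Rightarrow> complex) \<Rightarrow> real \<Rightarrow> complex \<Rightarrow> complex \<Rightarrow> complex" where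
  "circle_integrand F \<Psi> s z = branch_powr \<Psi> z (- s) * (deriv F z / F z)"

end

theory Submission
  imports Defs
begin

text \<open>
  The formula is a residue computation for \<open>z\<^sup>-\<^sup>s F'(z) / F(z)\<close> on a keyhole contour around the branch
  cut: at every zero \<open>a\<^sub>n\<close> the residue is \<open>a\<^sub>n\<^sup>-\<^sup>s\<close>, the two sides of the cut combine to the factor
  \<open>sin (\<pi>s)\<close> times the ray integral, and the rest is the small circle. Closing the contour
  directly would need estimates of \<open>F'/F\<close> on large circles that avoid the zeros. Instead, the
  residue computation is carried out separately for every term of the partial fraction expansion
  \[ F'(z)/F(z) = \omega'(z) + \sum_n \frac{z^p}{a_n^p (z - a_n)}, \qquad p = \lfloor\alpha\rfloor, \]
  where large circles are harmless, and the results are added up.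

  For one term, the substitution \<open>z = exp \<zeta>\<close> turns the keyhole into a rectangle, and the residue
  theorem yields \<open>keyhole_pole\<close>. The polynomial part contributes nothing (\<open>keyhole_pderiv\<close>). The sum
  over \<open>n\<close> may be interchanged with the integrals (\<open>keyhole_logderiv_H\<close>) because the zeros stay away
  from the ray by a fixed angle: on the ray this bounds the \<open>n\<close>-th term by a multiple of
  \<open>|a\<^sub>n|\<^sup>-\<^sup>\<tau> t\<^sup>\<tau>\<^sup>-\<^sup>1\<close> for any \<open>\<tau>\<close> between \<open>p\<close> and \<open>p + 1\<close> (\<open>pole_term_ray_bound\<close>), and \<open>\<tau>\<close> can be
  placed strictly between \<open>\<alpha>\<close> and \<open>Re s\<close>. The formulas with an integral from \<open>0\<close> follow by letting
  the circle shrink (\<open>zeta_integral_logderiv_H\<close>), which works as long as \<open>\<omega>'\<close> is absent, since the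
  sum alone is of order \<open>|z|\<^sup>p\<close> at the origin.
\<close>

section \<open>The residue theorem in logarithmic coordinates\<close>

text \<open>
  In the logarithmic coordinate \<open>z = exp \<zeta>\<close> the form \<open>z\<^sup>-\<^sup>s f(z) dz\<close> becomes
  \<open>exp ((1 - s) \<zeta>) f(exp \<zeta>) d\<zeta>\<close>, which is single valued: the branch cut turns into the two
  horizontal sides of a rectangle of height \<open>2\<pi>\<close>. Although \<open>exp\<close> identifies these sides, only one
  logarithm \<open>\<beta>\<close> of the pole lies between them, so the residue theorem picks up one residue.
\<close>
lemma contour_integral_rectpath_exp_pole:
  fixes g :: "complex \<Rightarrow> complex" and \<theta> x0 x1 :: real and \<beta> s :: complex
  assumes g: "g holomorphic_on UNIV"
    and Im: "\<theta> < Im \<beta>" "Im \<beta> < \<theta> + 2 * pi" and Re: "x0 < Re \<beta>" "Re \<beta> < x1"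
  shows "contour_integral (rectpath (Complex x0 \<theta>) (Complex x1 (\<theta> + 2 * pi)))
           (\<lambda>\<zeta>. exp ((1 - s) * \<zeta>) * (g (exp \<zeta>) / (exp \<zeta> - exp \<beta>))) =
         2 * pi * \<i> * (exp (- s * \<beta>) * g (exp \<beta>))"
proof -
  let ?h = "\<lambda>\<zeta>. exp ((1 - s) * \<zeta>) * (g (exp \<zeta>) / (exp \<zeta> - exp \<beta>))"
  let ?r = "rectpath (Complex x0 \<theta>) (Complex x1 (\<theta> + 2 * pi))"
  \<comment> \<open>The margin \<open>\<delta>\<close> thickens the strip as far as possible without letting in the neighbouring
    poles \<open>\<beta> \<plusminus> 2\<pi>\<i>\<close>.\<close>
  define \<delta> where "\<delta> = min (Im \<beta> - \<theta>) (\<theta> + 2 * pi - Im \<beta>)"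
  define S where "S = {\<zeta>. \<theta> - \<delta> < Im \<zeta>} \<inter> {\<zeta>. Im \<zeta> < \<theta> + 2 * pi + \<delta>}"
  have \<delta>: "\<delta> > 0" using Im by (simp add: \<delta>_def)
  have S: "open S" "connected S"
    unfolding S_def
    by (auto intro!: open_Int open_halfspace_Im_gt open_halfspace_Im_lt convex_connected
          convex_Int convex_halfspace_Im_gt convex_halfspace_Im_lt)
  have \<beta>S: "\<beta> \<in> S" using Im \<delta> by (simp add: S_def)
  have ne: "exp \<zeta> \<noteq> exp \<beta>" if "\<zeta> \<in> S" "\<zeta> \<noteq> \<beta>" for \<zeta>
  proof
    assume "exp \<zeta> = exp \<beta>"
    moreover have "\<bar>Im \<zeta> - Im \<beta>\<bar> < 2 * pi"
      using \<open>\<zeta> \<in> S\<close> unfolding S_def \<delta>_def by auto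
    ultimately show False using exp_complex_eqI \<open>\<zeta> \<noteq> \<beta>\<close> by blast
  qed
  have gexp: "(\<lambda>\<zeta>. g (exp \<zeta>)) holomorphic_on A" for A
    using holomorphic_on_compose[of exp A g] g
    by (auto simp: o_def intro: holomorphic_on_subset holomorphic_intros)
  have holo: "?h holomorphic_on S - {\<beta>}"
    using ne by (intro holomorphic_intros gexp) auto
  have box: "\<beta> \<in> box (Complex x0 \<theta>) (Complex x1 (\<theta> + 2 * pi))"
    using Im Re by (simp add: in_box_complex_iff)
  have img: "path_image ?r \<subseteq> S - {\<beta>}"
    using box Im Re \<delta> by (subst path_image_rectpath_cbox_minus_box)
      (auto simp: S_def in_cbox_complex_iff)
  have "residue ?h \<beta> = exp ((1 - s) * \<beta>) * (g (exp \<beta>) / exp \<beta>)"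
  proof (rule residue_simple'[OF S(1) \<beta>S holo])
    have "(exp has_field_derivative exp \<beta>) (at \<beta>)" by (rule DERIV_exp)
    then have 1: "((\<lambda>w. (exp w - exp \<beta>) / (w - \<beta>)) \<longlongrightarrow> exp \<beta>) (at \<beta>)"
      by (simp add: has_field_derivative_iff)
    have "isCont (\<lambda>w. g (exp w)) \<beta>"
      using gexp[of UNIV] holomorphic_on_imp_continuous_on continuous_on_eq_continuous_at by blast
    then have 2: "((\<lambda>w. g (exp w)) \<longlongrightarrow> g (exp \<beta>)) (at \<beta>)" by (simp add: isCont_def)
    have "((\<lambda>w. exp ((1 - s) * w) * (g (exp w) / ((exp w - exp \<beta>) / (w - \<beta>))))
            \<longlongrightarrow> exp ((1 - s) * \<beta>) * (g (exp \<beta>) / exp \<beta>)) (at \<beta>)"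
      by (intro tendsto_intros 1 2) auto
    then show "((\<lambda>w. ?h w * (w - \<beta>)) \<longlongrightarrow> exp ((1 - s) * \<beta>) * (g (exp \<beta>) / exp \<beta>)) (at \<beta>)"
      by (simp add: field_simps)
  qed
  also have "\<dots> = exp (- s * \<beta>) * g (exp \<beta>)"
    by (simp add: exp_diff exp_minus field_simps)
  finally have res: "residue ?h \<beta> = exp (- s * \<beta>) * g (exp \<beta>)" .
  have "contour_integral ?r ?h =
          2 * pi * \<i> * (\<Sum>p\<in>{\<beta>}. winding_number ?r p * residue ?h p)"
  proof (rule Residue_theorem[OF S])
    show "\<forall>z. z \<notin> S \<longrightarrow> winding_number ?r z = 0"
      using Im Re \<delta> by (intro allI impI winding_number_rectpath_outside)
        (auto simp: S_def in_cbox_complex_iff)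
  qed (use holo img in auto)
  with res winding_number_rectpath[OF box] show ?thesis by simp
qed

lemma contour_integral_linepath_same_Im:
  assumes "x0 < x1"
  shows "contour_integral (linepath (Complex x0 y) (Complex x1 y)) f =
         integral {x0..x1} (\<lambda>x. f (Complex x y))"
proof -
  have "contour_integral (linepath (Complex x0 y) (Complex x1 y)) f =
        contour_integral (linepath (of_real x0) (of_real x1)) (\<lambda>x. f (x + \<i> * y))"
    by (simp add: contour_integral_integral Complex_eq linepath_def algebra_simps scaleR_conv_of_real)
  also have "\<dots> = integral {x0..x1} (\<lambda>x. f (Complex x y))"
    using assms by (subst contour_integral_linepath_Reals_eq) (auto simp: Complex_eq)
  finally show ?thesis .
qed

text \<open>
  The signs come from the counterclockwise orientation of the rectangle: its top and left sides are
  run through backwards.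
\<close>
lemma contour_integral_rectpath_sides:
  assumes h: "continuous_on (path_image (rectpath (Complex x0 y0) (Complex x1 y1))) h"
    and x: "x0 < x1" and y: "y0 < y1"
  shows "contour_integral (rectpath (Complex x0 y0) (Complex x1 y1)) h =
     integral {x0..x1} (\<lambda>x. h (Complex x y0)) - integral {x0..x1} (\<lambda>x. h (Complex x y1))
     + \<i> * integral {y0..y1} (\<lambda>y. h (Complex x1 y)) - \<i> * integral {y0..y1} (\<lambda>y. h (Complex x0 y))"
proof -
  define A B C D where "A = Complex x0 y0" and "B = Complex x1 y0" and "C = Complex x1 y1"
    and "D = Complex x0 y1"
  have eq: "rectpath A C = linepath A B +++ linepath B C +++ linepath C D +++ linepath D A"
    by (simp add: rectpath_def Let_def A_def B_def C_def D_def)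
  have img: "path_image (rectpath A C) =
      closed_segment A B \<union> closed_segment B C \<union> closed_segment C D \<union> closed_segment D A"
    by (auto simp: eq path_image_join)
  have h': "continuous_on (path_image (rectpath A C)) h" using h by (simp add: A_def C_def)
  have i: "h contour_integrable_on linepath A B" "h contour_integrable_on linepath B C"
       "h contour_integrable_on linepath C D" "h contour_integrable_on linepath D A"
    using continuous_on_subset[OF h'] img
    by (auto intro!: contour_integrable_continuous_linepath)
  have "contour_integral (rectpath A C) h = contour_integral (linepath A B) h +
     contour_integral (linepath B C) h + contour_integral (linepath C D) h +
     contour_integral (linepath D A) h"
    using i by (simp add: eq contour_integrable_join)
  also have "contour_integral (linepath C D) h = - contour_integral (linepath D C) h"
    using contour_integral_reversepath[of "linepath D C" h] by simp
  also have "contour_integral (linepath D A) h = - contour_integral (linepath A D) h"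
    using contour_integral_reversepath[of "linepath A D" h] by simp
  also have "contour_integral (linepath D C) h = integral {x0..x1} (\<lambda>x. h (Complex x y1))"
    unfolding C_def D_def by (rule contour_integral_linepath_same_Im[OF x])
  also have "contour_integral (linepath A B) h = integral {x0..x1} (\<lambda>x. h (Complex x y0))"
    unfolding A_def B_def by (rule contour_integral_linepath_same_Im[OF x])
  also have "contour_integral (linepath A D) h = \<i> * integral {y0..y1} (\<lambda>y. h (Complex x0 y))"
    unfolding A_def D_def by (rule contour_integral_linepath_same_Re) (use y in auto)
  also have "contour_integral (linepath B C) h = \<i> * integral {y0..y1} (\<lambda>y. h (Complex x1 y))"
    unfolding B_def C_def by (rule contour_integral_linepath_same_Re) (use y in auto)
  finally show ?thesis by (simp add: A_def C_def)
qed

section \<open>The branch of the power and the sector\<close>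

text \<open>
  A point \<open>z\<close> outside the sector makes an angle of at least \<open>\<epsilon>\<close> with the ray, so by the law of
  cosines its squared distance to \<open>t e\<^sup>i\<^sup>\<Psi>\<close> is at least \<open>t\<^sup>2 + |z|\<^sup>2 - 2 t |z| \<kappa>\<close> with \<open>\<kappa> < 1\<close>. The
  constant depends on the width of the sector but neither on \<open>z\<close> nor on \<open>t\<close>.
\<close>
lemma sector_complement_dist:
  assumes "\<epsilon> > 0"
  obtains c where "c > 0"
    "\<And>z t. z \<in> sector_complement \<Psi> \<epsilon> \<Longrightarrow> t \<ge> 0 \<Longrightarrow> c * (t + norm z) \<le> norm (of_real t * cis \<Psi> - z)"
proof -
  define \<kappa> where "\<kappa> = cos (min \<epsilon> pi)"
  have "cos (min \<epsilon> pi) < cos 0"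
    using assms by (intro cos_monotone_0_pi) auto
  then have \<kappa>: "\<kappa> < 1" "-1 \<le> \<kappa>" by (simp_all add: \<kappa>_def)
  have "sqrt ((1 - \<kappa>) / 2) * (t + norm z) \<le> norm (of_real t * cis \<Psi> - z)"
    if z: "z \<in> sector_complement \<Psi> \<epsilon>" and t: "t \<ge> 0" for z t
  proof -
    define r where "r = norm z"
    \<comment> \<open>The shift \<open>m\<close> brings the angle \<open>x\<close> from the ray to \<open>z\<close> into \<open>[-\<pi>, \<pi>]\<close>, where the
      cosine is monotone in \<open>\<bar>x\<bar>\<close>.\<close>
    obtain m :: int where m: "- of_int m \<le> (Arg z - \<Psi> + pi) / (2 * pi)"
        "(Arg z - \<Psi> + pi) / (2 * pi) < - of_int m + 1"
      using that[of "- \<lfloor>(Arg z - \<Psi> + pi) / (2 * pi)\<rfloor>"] by linarith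
    define x where "x = Arg z - \<Psi> + 2 * pi * of_int m"
    have "\<bar>x\<bar> \<le> pi"
      using m unfolding x_def abs_le_iff by (simp add: field_simps)
    moreover have "Arg z + 2 * pi * of_int m \<notin> {\<Psi> - \<epsilon><..<\<Psi> + \<epsilon>}"
      using z unfolding sector_complement_def by blast
    then have "\<epsilon> \<le> \<bar>x\<bar>" by (auto simp: x_def)
    ultimately have "cos \<bar>x\<bar> \<le> \<kappa>"
      unfolding \<kappa>_def using assms by (intro cos_monotone_0_pi_le) auto
    moreover have "cos \<bar>x\<bar> = cos (Arg z - \<Psi>)"
      using cos.plus_of_int[of "Arg z - \<Psi>" m] by (simp add: x_def mult_ac)
    ultimately have cos_le: "cos (Arg z - \<Psi>) \<le> \<kappa>" by simp
    have "Re z = r * cos (Arg z)" "Im z = r * sin (Arg z)"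
      using rcis_cmod_Arg[of z] by (metis r_def Re_rcis, metis r_def Im_rcis)
    then have "(norm (of_real t * cis \<Psi> - z))\<^sup>2 =
        (t * cos \<Psi> - r * cos (Arg z))\<^sup>2 + (t * sin \<Psi> - r * sin (Arg z))\<^sup>2"
      by (simp add: cmod_power2)
    also have "\<dots> = t\<^sup>2 * ((sin \<Psi>)\<^sup>2 + (cos \<Psi>)\<^sup>2) + r\<^sup>2 * ((sin (Arg z))\<^sup>2 + (cos (Arg z))\<^sup>2)
        - 2 * (t * r) * (cos (Arg z) * cos \<Psi> + sin (Arg z) * sin \<Psi>)"
      by algebra
    finally have norm_eq: "(norm (of_real t * cis \<Psi> - z))\<^sup>2 = t\<^sup>2 + r\<^sup>2 - 2 * (t * r) * cos (Arg z - \<Psi>)"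
      by (simp add: cos_diff)
    have "2 * (t * r) * cos (Arg z - \<Psi>) \<le> 2 * (t * r) * \<kappa>"
      using t cos_le by (intro mult_left_mono) (auto simp: r_def)
    moreover have "t\<^sup>2 + r\<^sup>2 - 2 * (t * r) * \<kappa> = (1 - \<kappa>) / 2 * (t + r)\<^sup>2 + (1 + \<kappa>) / 2 * (t - r)\<^sup>2"
      by (simp add: power2_eq_square field_simps)
    moreover have "(1 + \<kappa>) / 2 * (t - r)\<^sup>2 \<ge> 0"
      using \<kappa> by simp
    ultimately have "(1 - \<kappa>) / 2 * (t + r)\<^sup>2 \<le> (norm (of_real t * cis \<Psi> - z))\<^sup>2"
      using norm_eq by linarith
    then have "sqrt ((1 - \<kappa>) / 2 * (t + r)\<^sup>2) \<le> norm (of_real t * cis \<Psi> - z)"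
      by (intro real_le_lsqrt) auto
    moreover have "sqrt ((1 - \<kappa>) / 2 * (t + r)\<^sup>2) = sqrt ((1 - \<kappa>) / 2) * (t + r)"
      using t unfolding real_sqrt_mult by (simp add: r_def)
    ultimately show ?thesis unfolding r_def by simp
  qed
  with that[of "sqrt ((1 - \<kappa>) / 2)"] \<kappa> show ?thesis by auto
qed

lemma branch_arg_polar:
  assumes "r > 0" "\<Psi> - 2 * pi < \<theta>" "\<theta> \<le> \<Psi>"
  shows "branch_arg \<Psi> (of_real r * cis \<theta>) = \<theta>"
  unfolding branch_arg_def
proof (rule the_equality)
  show "\<Psi> - 2 * pi < \<theta> \<and> \<theta> \<le> \<Psi> \<and> of_real r * cis \<theta> = of_real (norm (of_real r * cis \<theta>)) * cis \<theta>"
    using assms by (simp add: norm_mult)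
next
  fix \<phi> assume \<phi>: "\<Psi> - 2 * pi < \<phi> \<and> \<phi> \<le> \<Psi> \<and>
      of_real r * cis \<theta> = of_real (norm (of_real r * cis \<theta>)) * cis \<phi>"
  then have "cis \<theta> = cis \<phi>" using assms(1) by (simp add: norm_mult)
  then have "exp (\<i> * of_real \<phi>) = exp (\<i> * of_real \<theta>)" by (simp add: cis_conv_exp)
  moreover have "\<bar>Im (\<i> * of_real \<phi>) - Im (\<i> * of_real \<theta>)\<bar> < 2 * pi"
    using \<phi> assms by (auto simp: abs_less_iff)
  ultimately have "\<i> * of_real \<phi> = \<i> * of_real \<theta>" by (metis exp_complex_eqI)
  then show "\<phi> = \<theta>" by simp
qed

lemma branch_powr_polar:
  assumes "r > 0" "\<Psi> - 2 * pi < \<theta>" "\<theta> \<le> \<Psi>"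
  shows "branch_powr \<Psi> (of_real r * cis \<theta>) w = exp (w * Complex (ln r) \<theta>)"
  using assms by (simp add: branch_powr_def branch_arg_polar norm_mult Complex_eq)

text \<open>
  Off the sector the branch of the power comes from a logarithm in the open strip, as the keyhole
  contour requires; at the edge \<open>Im \<beta> = \<Psi>\<close> the pole would sit on the contour.
\<close>
lemma sector_complement_branch_log:
  assumes "z \<in> sector_complement \<Psi> \<epsilon>" "\<epsilon> > 0" "z \<noteq> 0"
  obtains \<beta> where "exp \<beta> = z" "\<Psi> - 2 * pi < Im \<beta>" "Im \<beta> < \<Psi>"
    "\<And>w. branch_powr \<Psi> z w = exp (w * \<beta>)"
proof -
  define m where "m = \<lfloor>(\<Psi> - Arg z) / (2 * pi)\<rfloor>"
  define \<theta> where "\<theta> = Arg z + 2 * pi * of_int m"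
  have "of_int m \<le> (\<Psi> - Arg z) / (2 * pi)" "(\<Psi> - Arg z) / (2 * pi) < of_int m + 1"
    unfolding m_def by linarith+
  then have \<theta>: "\<theta> \<le> \<Psi>" "\<Psi> - 2 * pi < \<theta>"
    unfolding \<theta>_def by (simp_all add: field_simps)
  moreover have "\<theta> \<notin> {\<Psi> - \<epsilon><..<\<Psi> + \<epsilon>}"
    using assms(1) unfolding sector_complement_def \<theta>_def by blast
  ultimately have "\<theta> < \<Psi>" using assms(2) by (cases "\<theta> = \<Psi>") auto
  have "cis \<theta> = cis (Arg z)"
    using cos.plus_of_int[of "Arg z" m] sin.plus_of_int[of "Arg z" m]
    by (simp add: \<theta>_def complex_eq_iff mult_ac)
  then have z: "z = of_real (norm z) * cis \<theta>"
    by (simp add: rcis_def[symmetric] rcis_cmod_Arg)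
  have "norm z > 0" using assms(3) by simp
  show ?thesis
  proof (rule that[of "Complex (ln (norm z)) \<theta>"])
    show "exp (Complex (ln (norm z)) \<theta>) = z"
      using z \<open>norm z > 0\<close> by (simp add: exp_eq_polar)
    show "branch_powr \<Psi> z w = exp (w * Complex (ln (norm z)) \<theta>)" for w
      using branch_powr_polar[OF \<open>norm z > 0\<close> \<theta>(2,1)] z by simp
  qed (use \<theta> \<open>\<theta> < \<Psi>\<close> in auto)
qed

section \<open>Keyhole integrals\<close>

text \<open>
  Pullbacks of the form \<open>z\<^sup>-\<^sup>s f(z) dz\<close> to the ray and to a circle. On the ray the constant phase
  of \<open>z\<^sup>-\<^sup>s\<close> is left out, because it takes a different value on each side of the cut. On the circle
  the power is written in polar coordinates, so that the integrand is continuous up to both ends of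
  the interval of angles.
\<close>
definition ray_pullback :: "(complex \<Rightarrow> complex) \<Rightarrow> real \<Rightarrow> complex \<Rightarrow> real \<Rightarrow> complex" where
  "ray_pullback f \<Psi> s t = of_real t powr (- s) * (cis \<Psi> * f (of_real t * cis \<Psi>))"

definition circle_pullback :: "(complex \<Rightarrow> complex) \<Rightarrow> complex \<Rightarrow> real \<Rightarrow> real \<Rightarrow> complex" where
  "circle_pullback f s R \<theta> = \<i> * (exp ((1 - s) * Complex (ln R) \<theta>) * f (of_real R * cis \<theta>))"

text \<open>
  This is \<open>1 / (2\<pi>\<i>)\<close> times the integral of \<open>z\<^sup>-\<^sup>s f(z) dz\<close> over the keyhole contour that comes in
  from infinity along one side of the cut, runs clockwise around the circle of radius \<open>R\<close>, and
  returns to infinity along the other side. The factor \<open>sin (\<pi>s)\<close> comes from the difference of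
  the phases of \<open>z\<^sup>-\<^sup>s\<close> on the two sides.
\<close>
definition keyhole :: "(complex \<Rightarrow> complex) \<Rightarrow> real \<Rightarrow> complex \<Rightarrow> real \<Rightarrow> complex" where
  "keyhole f \<Psi> s R =
     exp (\<i> * s * of_real (pi - \<Psi>)) * (sin (of_real pi * s) / of_real pi) *
       (LINT t:{R<..}|lborel. ray_pullback f \<Psi> s t)
     - 1 / (2 * of_real pi * \<i>) * integral {\<Psi> - 2 * pi..\<Psi>} (circle_pullback f s R)"

lemma norm_ray_pullback:
  assumes "t > 0"
  shows "norm (ray_pullback f \<Psi> s t) = t powr (- Re s) * norm (f (of_real t * cis \<Psi>))"
  using assms by (simp add: ray_pullback_def norm_mult norm_powr_real_powr)

text \<open>
  For non-real \<open>s\<close> the modulus of \<open>z\<^sup>-\<^sup>s\<close> varies along a circle, but only by a factor that does not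
  depend on the radius.
\<close>
lemma norm_circle_pullback_le:
  assumes R: "R > 0" and \<theta>: "\<theta> \<in> {\<Psi> - 2 * pi..\<Psi>}" and f: "norm (f (of_real R * cis \<theta>)) \<le> B"
  shows "norm (circle_pullback f s R \<theta>) \<le>
           R powr (1 - Re s) * exp (\<bar>Im s\<bar> * (\<bar>\<Psi>\<bar> + 2 * pi)) * B"
proof -
  have "\<bar>\<theta>\<bar> \<le> \<bar>\<Psi>\<bar> + 2 * pi" using \<theta> by (simp add: abs_le_iff) linarith
  then have "\<bar>Im s * \<theta>\<bar> \<le> \<bar>Im s\<bar> * (\<bar>\<Psi>\<bar> + 2 * pi)"
    unfolding abs_mult by (rule mult_left_mono) simp
  then have "Im s * \<theta> \<le> \<bar>Im s\<bar> * (\<bar>\<Psi>\<bar> + 2 * pi)" by linarith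
  moreover have "norm (exp ((1 - s) * Complex (ln R) \<theta>)) = R powr (1 - Re s) * exp (Im s * \<theta>)"
  proof -
    have "Re ((1 - s) * Complex (ln R) \<theta>) = (1 - Re s) * ln R + Im s * \<theta>" by simp
    then show ?thesis using R by (simp only: norm_exp_eq_Re exp_add powr_def) simp
  qed
  ultimately have le: "norm (exp ((1 - s) * Complex (ln R) \<theta>)) \<le>
               R powr (1 - Re s) * exp (\<bar>Im s\<bar> * (\<bar>\<Psi>\<bar> + 2 * pi))"
    by (simp add: mult_left_mono)
  have "norm (circle_pullback f s R \<theta>) =
          norm (exp ((1 - s) * Complex (ln R) \<theta>)) * norm (f (of_real R * cis \<theta>))"
    by (simp only: circle_pullback_def norm_mult norm_ii mult_1)
  also have "\<dots> \<le> R powr (1 - Re s) * exp (\<bar>Im s\<bar> * (\<bar>\<Psi>\<bar> + 2 * pi)) * B"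
    by (rule mult_mono[OF le f]) auto
  finally show ?thesis .
qed

lemma norm_integral_circle_pullback_le:
  assumes R: "R > 0" and f: "\<And>\<theta>. \<theta> \<in> {\<Psi> - 2 * pi..\<Psi>} \<Longrightarrow> norm (f (of_real R * cis \<theta>)) \<le> B"
    and B: "B \<ge> 0"
  shows "norm (integral {\<Psi> - 2 * pi..\<Psi>} (circle_pullback f s R)) \<le>
           2 * pi * (R powr (1 - Re s) * exp (\<bar>Im s\<bar> * (\<bar>\<Psi>\<bar> + 2 * pi)) * B)"
proof (cases "circle_pullback f s R integrable_on {\<Psi> - 2 * pi..\<Psi>}")
  case True
  have "norm (integral {\<Psi> - 2 * pi..\<Psi>} (circle_pullback f s R)) \<le>
      (R powr (1 - Re s) * exp (\<bar>Im s\<bar> * (\<bar>\<Psi>\<bar> + 2 * pi)) * B) * measure lborel {\<Psi> - 2 * pi..\<Psi>}"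
    using integrable_integral[OF True]
  proof (rule has_integral_bound_real[rotated 2])
    show "norm (circle_pullback f s R \<theta>) \<le>
        R powr (1 - Re s) * exp (\<bar>Im s\<bar> * (\<bar>\<Psi>\<bar> + 2 * pi)) * B"
      if "\<theta> \<in> {\<Psi> - 2 * pi..\<Psi>} - {}" for \<theta>
      by (rule norm_circle_pullback_le[OF R]) (use that f in auto)
  qed (use B in auto)
  then show ?thesis by (simp add: mult.commute)
next
  case False
  then show ?thesis using B by (simp add: not_integrable_integral)
qed

lemma set_integrable_powr_at_top:
  fixes e R :: real
  assumes "e < -1" "R > 0"
  shows "set_integrable lborel {R..} (\<lambda>t. t powr e)"
proof -
  have "(\<lambda>t. t powr e) absolutely_integrable_on {R..}"
    using has_integral_powr_to_inf[OF assms]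
    by (intro nonnegative_absolutely_integrable_1) auto
  then show ?thesis
    unfolding set_integrable_def
    by (subst (asm) integrable_completion) auto
qed

lemma set_integrable_powr_at_0:
  fixes e R :: real
  assumes "e > -1" "R \<ge> 0"
  shows "set_integrable lborel {0<..R} (\<lambda>t. t powr e)"
proof -
  have "(\<lambda>t. t powr e) absolutely_integrable_on {0..R}"
    using integrable_on_powr_from_0[OF assms]
    by (intro nonnegative_absolutely_integrable_1) auto
  then have "set_integrable lborel {0..R} (\<lambda>t. t powr e)"
    unfolding set_integrable_def
    by (subst (asm) integrable_completion) auto
  then show ?thesis by (rule set_integrable_subset) auto
qed

lemma set_integrable_ray_pullback_at_top:
  assumes R: "R > 0" and cont: "continuous_on {R..} (\<lambda>t. f (of_real t * cis \<Psi>))"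
    and bound: "\<And>t. t \<ge> R \<Longrightarrow> norm (f (of_real t * cis \<Psi>)) \<le> K * t powr (q - 1)"
    and q: "q < Re s"
  shows "set_integrable lborel {R..} (ray_pullback f \<Psi> s)"
proof (rule set_integrable_bound)
  show "set_integrable lborel {R..} (\<lambda>t. K * t powr (q - 1 - Re s))"
    using q R by (intro set_integrable_mult_right set_integrable_powr_at_top) auto
  have "continuous_on {R..} (ray_pullback f \<Psi> s)"
    unfolding ray_pullback_def using R by (intro continuous_intros cont) (auto simp: complex_nonpos_Reals_iff)
  then show "set_borel_measurable lborel {R..} (ray_pullback f \<Psi> s)"
    unfolding set_borel_measurable_def
    using borel_measurable_continuous_on_indicator[of "{R..}"] by auto
  have "norm (ray_pullback f \<Psi> s t) \<le> K * t powr (q - 1 - Re s)" if "t \<ge> R" for t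
  proof -
    have "norm (ray_pullback f \<Psi> s t) \<le> t powr (- Re s) * (K * t powr (q - 1))"
      using that R bound[OF that] by (subst norm_ray_pullback) (auto intro!: mult_left_mono)
    also have "\<dots> = K * t powr (q - 1 - Re s)"
      using powr_add[of t "q - 1" "- Re s"] by simp
    finally show ?thesis .
  qed
  then show "AE t in lborel. t \<in> {R..} \<longrightarrow>
      norm (ray_pullback f \<Psi> s t) \<le> norm (K * t powr (q - 1 - Re s))"
    by (intro AE_I2 impI) (metis atLeast_iff abs_ge_self order_trans real_norm_def)
qed

lemma set_lebesgue_integral_Ici_eq_Ioi:
  fixes f :: "real \<Rightarrow> complex"
  assumes "set_integrable lborel {R..} f"
  shows "(LINT t:{R..}|lborel. f t) = (LINT t:{R<..}|lborel. f t)"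
proof -
  have "set_integrable lborel {R<..} f" using assms by (rule set_integrable_subset) auto
  moreover have "AE x in lborel. indicat_real {R..} x *\<^sub>R f x = indicat_real {R<..} x *\<^sub>R f x"
    using AE_lborel_singleton[of R] by eventually_elim (auto simp: indicator_def)
  ultimately show ?thesis
    using assms unfolding set_lebesgue_integral_def set_integrable_def
    by (intro integral_cong_AE borel_measurable_integrable)
qed

lemma keyhole_cong:
  assumes "\<And>t. t > R \<Longrightarrow> f (of_real t * cis \<Psi>) = g (of_real t * cis \<Psi>)"
    and "\<And>\<theta>. f (of_real R * cis \<theta>) = g (of_real R * cis \<theta>)"
  shows "keyhole f \<Psi> s R = keyhole g \<Psi> s R"
proof -
  have "(LINT t:{R<..}|lborel. ray_pullback f \<Psi> s t) = (LINT t:{R<..}|lborel. ray_pullback g \<Psi> s t)"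
    by (intro set_lebesgue_integral_cong) (auto simp: ray_pullback_def assms(1))
  moreover have "circle_pullback f s R = circle_pullback g s R"
    by (auto simp: circle_pullback_def assms(2))
  ultimately show ?thesis by (simp add: keyhole_def)
qed

lemma keyhole_add:
  assumes "set_integrable lborel {R<..} (ray_pullback f \<Psi> s)" "set_integrable lborel {R<..} (ray_pullback g \<Psi> s)"
    and "circle_pullback f s R integrable_on {\<Psi> - 2 * pi..\<Psi>}" "circle_pullback g s R integrable_on {\<Psi> - 2 * pi..\<Psi>}"
  shows "keyhole (\<lambda>z. f z + g z) \<Psi> s R = keyhole f \<Psi> s R + keyhole g \<Psi> s R"
proof -
  have "ray_pullback (\<lambda>z. f z + g z) \<Psi> s = (\<lambda>t. ray_pullback f \<Psi> s t + ray_pullback g \<Psi> s t)"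
       "circle_pullback (\<lambda>z. f z + g z) s R = (\<lambda>\<theta>. circle_pullback f s R \<theta> + circle_pullback g s R \<theta>)"
    by (auto simp: ray_pullback_def circle_pullback_def algebra_simps)
  moreover have "c * (x + y) - d * (u + v) = (c * x - d * u) + (c * y - d * v)" for c d x y u v :: complex
    by (simp add: algebra_simps)
  ultimately show ?thesis
    by (simp only: keyhole_def set_integral_add(2)[OF assms(1,2)] integral_add[OF assms(3,4)])
qed

lemma ray_integrand_eq:
  assumes "F holomorphic_on UNIV"
  shows "ray_integrand F \<Psi> s t = ray_pullback (\<lambda>z. deriv F z / F z) \<Psi> s t"
proof -
  have "((\<lambda>u. F (of_real u * cis \<Psi>)) has_vector_derivative cis \<Psi> * deriv F (of_real t * cis \<Psi>)) (at t)"
    using field_vector_diff_chain_at[of "\<lambda>u. of_real u * cis \<Psi>" "cis \<Psi>" t F "deriv F (of_real t * cis \<Psi>)"]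
      holomorphic_derivI[OF assms open_UNIV, of "of_real t * cis \<Psi>"]
      has_vector_derivative_mult_left[OF has_vector_derivative_of_real[OF DERIV_ident], of "cis \<Psi>" "at t"]
    by (simp add: o_def)
  then show ?thesis
    by (simp add: ray_integrand_def ray_pullback_def vector_derivative_at)
qed

text \<open>
  The two integrands differ at the starting angle \<open>\<Psi> - 2\<pi>\<close> only, where the branch of the power
  takes its value from the other side of the cut.
\<close>
lemma has_contour_integral_circle_integrand_iff:
  assumes "R > 0"
  shows "(circle_integrand F \<Psi> s has_contour_integral I) (part_circlepath 0 R (\<Psi> - 2 * pi) \<Psi>) \<longleftrightarrow>
     (circle_pullback (\<lambda>z. deriv F z / F z) s R has_integral I) {\<Psi> - 2 * pi..\<Psi>}"
proof -
  have eq: "circle_integrand F \<Psi> s (0 + of_real R * cis \<theta>) * of_real R * \<i> * cis \<theta> =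
      circle_pullback (\<lambda>z. deriv F z / F z) s R \<theta>" if "\<theta> \<in> {\<Psi> - 2 * pi..\<Psi>} - {\<Psi> - 2 * pi}" for \<theta>
  proof -
    have "exp ((1 - s) * Complex (ln R) \<theta>) = exp (Complex (ln R) \<theta> + (- s) * Complex (ln R) \<theta>)"
      by (simp add: algebra_simps)
    also have "\<dots> = of_real R * cis \<theta> * exp (- s * Complex (ln R) \<theta>)"
      unfolding exp_add using assms by (simp add: exp_eq_polar)
    finally have "exp ((1 - s) * Complex (ln R) \<theta>) =
        of_real R * cis \<theta> * branch_powr \<Psi> (of_real R * cis \<theta>) (- s)"
      using branch_powr_polar[OF assms, of \<Psi> \<theta>] that by simp
    then show ?thesis by (simp add: circle_integrand_def circle_pullback_def)
  qed
  have "\<Psi> - 2 * pi < \<Psi>" by simp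
  note has_contour_integral_part_circlepath_iff[OF this]
  also have "((\<lambda>\<theta>. circle_integrand F \<Psi> s (0 + of_real R * cis \<theta>) * of_real R * \<i> * cis \<theta>) has_integral I)
      {\<Psi> - 2 * pi..\<Psi>} \<longleftrightarrow>
      (circle_pullback (\<lambda>z. deriv F z / F z) s R has_integral I) {\<Psi> - 2 * pi..\<Psi>}"
    by (rule has_integral_spike_finite_eq[of "{\<Psi> - 2 * pi}"]) (use eq in auto)
  finally show ?thesis .
qed

lemma cis_ray_neq_exp:
  assumes "\<Psi> - 2 * pi < Im \<beta>" "Im \<beta> < \<Psi>" "t > 0"
  shows "of_real t * cis \<Psi> \<noteq> exp \<beta>"
proof
  assume "of_real t * cis \<Psi> = exp \<beta>"
  then have "exp (Complex (ln t) \<Psi>) = exp \<beta>"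
    using assms(3) by (simp add: exp_eq_polar)
  moreover have "\<bar>Im (Complex (ln t) \<Psi>) - Im \<beta>\<bar> < 2 * pi"
    using assms(1,2) by simp
  ultimately have "Complex (ln t) \<Psi> = \<beta>" by (metis exp_complex_eqI)
  with assms(2) show False by auto
qed

text \<open>
  The two horizontal sides of the logarithmic rectangle carry the same function up to the phases
  \<open>exp (- \<i>s\<Psi>)\<close> and \<open>exp (- \<i>s(\<Psi> - 2\<pi>))\<close>, so together they give a multiple of \<open>sin (\<pi>s)\<close>
  times the integral along the ray; the vertical sides are the circles of radius \<open>R\<close> and \<open>T\<close>.
\<close>
lemma keyhole_truncated:
  fixes g :: "complex \<Rightarrow> complex" and \<Psi> R T :: real and \<beta> s :: complex
  defines "f \<equiv> \<lambda>z. g z / (z - exp \<beta>)"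
  assumes g: "g holomorphic_on UNIV"
    and Im: "\<Psi> - 2 * pi < Im \<beta>" "Im \<beta> < \<Psi>"
    and R: "0 < R" "R < norm (exp \<beta>)" and T: "norm (exp \<beta>) < T"
  shows "exp (\<i> * s * of_real (pi - \<Psi>)) * (2 * \<i> * sin (of_real pi * s)) *
           integral {R..T} (ray_pullback f \<Psi> s)
         + integral {\<Psi> - 2 * pi..\<Psi>} (circle_pullback f s T)
         - integral {\<Psi> - 2 * pi..\<Psi>} (circle_pullback f s R)
         = 2 * pi * \<i> * (exp (- s * \<beta>) * g (exp \<beta>))"
proof -
  define h where "h = (\<lambda>\<zeta>. exp ((1 - s) * \<zeta>) * (g (exp \<zeta>) / (exp \<zeta> - exp \<beta>)))"
  have h_eq: "h \<zeta> = exp ((1 - s) * \<zeta>) * f (exp \<zeta>)" for \<zeta> by (simp add: h_def f_def)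
  have exp_Complex: "exp (Complex x y) = of_real (exp x) * cis y" for x y
    by (simp add: exp_eq_polar)
  from R have "ln R < ln (exp (Re \<beta>))" by (subst ln_less_cancel_iff) auto
  then have lnR: "ln R < Re \<beta>" by simp
  from R T have "T > 0" by linarith
  with T have "ln (exp (Re \<beta>)) < ln T" by (subst ln_less_cancel_iff) auto
  with \<open>T > 0\<close> have lnT: "Re \<beta> < ln T" "T > 0" by auto
  have box: "\<beta> \<in> box (Complex (ln R) (\<Psi> - 2 * pi)) (Complex (ln T) \<Psi>)"
    using Im lnR lnT by (simp add: in_box_complex_iff)
  have ne: "exp \<zeta> \<noteq> exp \<beta>"
    if "\<zeta> \<in> path_image (rectpath (Complex (ln R) (\<Psi> - 2 * pi)) (Complex (ln T) \<Psi>))" for \<zeta>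
  proof
    assume "exp \<zeta> = exp \<beta>"
    have \<zeta>: "\<zeta> \<in> cbox (Complex (ln R) (\<Psi> - 2 * pi)) (Complex (ln T) \<Psi>)"
      "\<zeta> \<notin> box (Complex (ln R) (\<Psi> - 2 * pi)) (Complex (ln T) \<Psi>)"
      using that lnR lnT by (auto simp: path_image_rectpath_cbox_minus_box)
    then have "\<bar>Im \<zeta> - Im \<beta>\<bar> < 2 * pi" using Im by (auto simp: in_cbox_complex_iff)
    with \<open>exp \<zeta> = exp \<beta>\<close> have "\<zeta> = \<beta>" by (metis exp_complex_eqI)
    with \<zeta> box show False by blast
  qed
  have gcont: "continuous_on A (\<lambda>\<zeta>. g (exp \<zeta>))" for A
    by (rule continuous_on_compose2[OF holomorphic_on_imp_continuous_on[OF g]])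
       (auto intro!: continuous_intros)
  have cont: "continuous_on (path_image (rectpath (Complex (ln R) (\<Psi> - 2 * pi)) (Complex (ln T) \<Psi>))) h"
    unfolding h_def using ne by (intro continuous_intros gcont) auto
  have ray_ne: "of_real t * cis \<Psi> \<noteq> exp \<beta>" if "t > 0" for t
    using cis_ray_neq_exp[OF Im that] .
  have ray_cont: "continuous_on {R..T} (ray_pullback f \<Psi> s)"
    unfolding ray_pullback_def f_def using R ray_ne
    by (intro continuous_intros continuous_on_compose2[OF holomorphic_on_imp_continuous_on[OF g]])
       (auto simp: complex_nonpos_Reals_iff)
  define J where "J = integral {R..T} (ray_pullback f \<Psi> s)"
  have sub: "((\<lambda>x. exp x *\<^sub>R ray_pullback f \<Psi> s (exp x)) has_integral J) {ln R..ln T}"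
  proof -
    have "exp ` {ln R..ln T} \<subseteq> {R..T}"
      using R lnT by auto (metis exp_le_cancel_iff exp_ln)+
    then have "((\<lambda>x. exp x *\<^sub>R ray_pullback f \<Psi> s (exp x)) has_integral
        integral {exp (ln R)..exp (ln T)} (ray_pullback f \<Psi> s)) {ln R..ln T}"
      using lnR lnT R T ray_cont
      by (intro has_integral_substitution[where c = R and d = T]) (auto intro!: derivative_eq_intros)
    then show ?thesis using R lnT by (simp add: J_def)
  qed
  have side: "integral {ln R..ln T} (\<lambda>x. h (Complex x y)) = c * J"
    if "\<And>x. h (Complex x y) = c * (exp x *\<^sub>R ray_pullback f \<Psi> s (exp x))" for y c
    unfolding that using has_integral_mult_right[OF sub, of c] by (rule integral_unique)
  have powr_exp: "of_real (exp x) powr (- s) = exp (- s * of_real x)" for x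
    by (simp add: powr_def Ln_of_real)
  have top: "h (Complex x \<Psi>) = exp (- \<i> * s * \<Psi>) * (exp x *\<^sub>R ray_pullback f \<Psi> s (exp x))" for x
  proof -
    have "exp ((1 - s) * Complex x \<Psi>) =
        exp (- \<i> * s * \<Psi>) * (exp (of_real x) * (exp (- s * of_real x) * cis \<Psi>))"
      unfolding cis_conv_exp exp_add[symmetric]
      by (rule arg_cong[of _ _ exp]) (simp add: Complex_eq algebra_simps)
    then show ?thesis
      unfolding h_eq ray_pullback_def exp_Complex powr_exp
      by (simp add: scaleR_conv_of_real exp_of_real mult_ac)
  qed
  have cis_2pi: "cis (\<Psi> - 2 * pi) = cis \<Psi>"
    by (simp add: complex_eq_iff cos_diff sin_diff)
  have bot: "h (Complex x (\<Psi> - 2 * pi)) = exp (2 * pi * \<i> * s - \<i> * s * \<Psi>) *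
      (exp x *\<^sub>R ray_pullback f \<Psi> s (exp x))" for x
  proof -
    have "h (Complex x (\<Psi> - 2 * pi)) =
        exp ((1 - s) * Complex x \<Psi> + 2 * pi * \<i> * s - 2 * pi * \<i>) * f (exp (Complex x \<Psi>))"
      unfolding h_eq exp_Complex cis_2pi by (simp add: Complex_eq algebra_simps)
    also have "\<dots> = exp (2 * pi * \<i> * s) * h (Complex x \<Psi>)"
      by (simp add: h_eq exp_diff exp_add)
    finally show ?thesis unfolding top by (simp add: exp_diff exp_minus field_simps)
  qed
  have circ: "\<i> * integral {\<Psi> - 2 * pi..\<Psi>} (\<lambda>y. h (Complex (ln r) y)) =
      integral {\<Psi> - 2 * pi..\<Psi>} (circle_pullback f s r)" if "r > 0" for r
    using that by (simp add: circle_pullback_def[abs_def] h_eq exp_Complex flip: integral_mult_right)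
  have "2 * pi * \<i> * (exp (- s * \<beta>) * g (exp \<beta>)) =
      contour_integral (rectpath (Complex (ln R) (\<Psi> - 2 * pi)) (Complex (ln T) \<Psi>)) h"
    using contour_integral_rectpath_exp_pole[OF g, of "\<Psi> - 2 * pi" \<beta> "ln R" "ln T" s] Im lnR lnT
    by (simp add: h_def)
  also have "\<dots> = (exp (2 * pi * \<i> * s - \<i> * s * \<Psi>) - exp (- \<i> * s * \<Psi>)) * J
      + integral {\<Psi> - 2 * pi..\<Psi>} (circle_pullback f s T)
      - integral {\<Psi> - 2 * pi..\<Psi>} (circle_pullback f s R)"
  proof -
    have "ln R < ln T" "\<Psi> - 2 * pi < \<Psi>" using lnR lnT by auto
    then show ?thesis
      unfolding contour_integral_rectpath_sides[OF cont \<open>ln R < ln T\<close> \<open>\<Psi> - 2 * pi < \<Psi>\<close>]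
        side[OF top] side[OF bot] circ[OF R(1)] circ[OF lnT(2)]
      by (simp only: left_diff_distrib)
  qed
  also have "exp (2 * pi * \<i> * s - \<i> * s * \<Psi>) - exp (- \<i> * s * \<Psi>) =
      exp (\<i> * s * of_real (pi - \<Psi>)) * (2 * \<i> * sin (of_real pi * s))"
  proof -
    have "2 * \<i> * sin (of_real pi * s) = exp (\<i> * (of_real pi * s)) - exp (- (\<i> * (of_real pi * s)))"
      by (simp add: sin_exp_eq)
    then show ?thesis
      unfolding right_diff_distrib exp_add[symmetric]
      by (simp only: right_diff_distrib exp_add[symmetric])
         (intro arg_cong2[of _ _ _ _ "(-)"] arg_cong[of _ _ exp]; simp add: algebra_simps)
  qed
  finally show ?thesis by (simp add: J_def)
qed

text \<open>
  Since \<open>q < Re s\<close>, a bound of order \<open>|z|\<^sup>q\<^sup>-\<^sup>1\<close> makes the ray integral absolutely convergent and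
  kills the outer circle, whose contribution is of order \<open>T powr (q - Re s)\<close>. Keeping a general numerator
  \<open>g\<close> has a second use: an entire integrand \<open>h\<close> is covered by \<open>g(z) = h(z) (z - exp \<beta>)\<close>, with value \<open>0\<close>.
\<close>
lemma keyhole_pole:
  fixes g :: "complex \<Rightarrow> complex" and \<Psi> R :: real and \<beta> s :: complex
  defines "f \<equiv> \<lambda>z. g z / (z - exp \<beta>)"
  assumes g: "g holomorphic_on UNIV"
    and Im: "\<Psi> - 2 * pi < Im \<beta>" "Im \<beta> < \<Psi>"
    and R: "0 < R" "R < norm (exp \<beta>)"
    and ray: "\<And>t. t \<ge> R \<Longrightarrow> norm (f (of_real t * cis \<Psi>)) \<le> K * t powr (q - 1)"
    and far: "\<And>z. norm z \<ge> T0 \<Longrightarrow> norm (f z) \<le> L * norm z powr (q - 1)"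
    and q: "q < Re s"
  shows "set_integrable lborel {R<..} (ray_pullback f \<Psi> s)"
    and "keyhole f \<Psi> s R = exp (- s * \<beta>) * g (exp \<beta>)"
proof -
  have cont: "continuous_on {R..} (\<lambda>t. f (of_real t * cis \<Psi>))"
    unfolding f_def using cis_ray_neq_exp[OF Im] R
    by (intro continuous_intros continuous_on_compose2[OF holomorphic_on_imp_continuous_on[OF g]]) auto
  have int: "set_integrable lborel {R..} (ray_pullback f \<Psi> s)"
    by (rule set_integrable_ray_pullback_at_top[OF R(1) cont ray q])
  then show "set_integrable lborel {R<..} (ray_pullback f \<Psi> s)"
    by (rule set_integrable_subset) auto
  define J where "J = (LINT t:{R<..}|lborel. ray_pullback f \<Psi> s t)"
  have "((\<lambda>T. LINT t:{R..T}|lborel. ray_pullback f \<Psi> s t) \<longlongrightarrow> J) at_top"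
    using tendsto_set_lebesgue_integral_at_top[OF _ int] set_lebesgue_integral_Ici_eq_Ioi[OF int]
    by (simp add: J_def)
  moreover have "(LINT t:{R..T}|lborel. ray_pullback f \<Psi> s t) = integral {R..T} (ray_pullback f \<Psi> s)" for T
    by (intro set_borel_integral_eq_integral set_integrable_subset[OF int]) auto
  ultimately have lim_ray: "((\<lambda>T. integral {R..T} (ray_pullback f \<Psi> s)) \<longlongrightarrow> J) at_top"
    by simp
  define C where "C = (\<lambda>T. integral {\<Psi> - 2 * pi..\<Psi>} (circle_pullback f s T))"
  define B where "B = exp (\<bar>Im s\<bar> * (\<bar>\<Psi>\<bar> + 2 * pi))"
  have "(C \<longlongrightarrow> 0) at_top"
  proof (rule Lim_null_comparison)
    show "\<forall>\<^sub>F T in at_top. norm (C T) \<le> 2 * pi * B * \<bar>L\<bar> * T powr (q - Re s)"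
      using eventually_ge_at_top[of T0] eventually_gt_at_top[of 0]
    proof eventually_elim
      case (elim T)
      have "norm (C T) \<le> 2 * pi * (T powr (1 - Re s) * B * (\<bar>L\<bar> * T powr (q - 1)))"
        unfolding C_def B_def
      proof (rule norm_integral_circle_pullback_le)
        show "norm (f (of_real T * cis \<theta>)) \<le> \<bar>L\<bar> * T powr (q - 1)" for \<theta>
        proof -
          have "norm (f (of_real T * cis \<theta>)) \<le> L * T powr (q - 1)"
            using elim far[of "of_real T * cis \<theta>"] by (simp add: norm_mult)
          also have "\<dots> \<le> \<bar>L\<bar> * T powr (q - 1)" by (intro mult_right_mono) auto
          finally show ?thesis .
        qed
      qed (use elim in auto)
      also have "T powr (1 - Re s) * B * (\<bar>L\<bar> * T powr (q - 1)) = B * \<bar>L\<bar> * T powr (q - Re s)"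
        using powr_add[of T "1 - Re s" "q - 1"] by simp
      finally show ?case by (simp add: mult_ac)
    qed
    have "((\<lambda>T. T powr (q - Re s)) \<longlongrightarrow> 0) at_top"
      using q by (intro tendsto_neg_powr filterlim_ident) auto
    from tendsto_mult_right_zero[OF this]
    show "((\<lambda>T. 2 * pi * B * \<bar>L\<bar> * T powr (q - Re s)) \<longlongrightarrow> 0) at_top" .
  qed
  define c where "c = exp (\<i> * s * of_real (pi - \<Psi>)) * (2 * \<i> * sin (of_real pi * s))"
  have "((\<lambda>T. c * integral {R..T} (ray_pullback f \<Psi> s) + C T - C R) \<longlongrightarrow> c * J + 0 - C R) at_top"
    by (intro tendsto_intros lim_ray \<open>(C \<longlongrightarrow> 0) at_top\<close>)
  moreover have "\<forall>\<^sub>F T in at_top. c * integral {R..T} (ray_pullback f \<Psi> s) + C T - C R =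
      2 * pi * \<i> * (exp (- s * \<beta>) * g (exp \<beta>))"
    using eventually_gt_at_top[of "norm (exp \<beta>)"]
    by eventually_elim
       (unfold c_def C_def f_def, rule keyhole_truncated[OF g Im R])
  ultimately have "((\<lambda>T::real. 2 * pi * \<i> * (exp (- s * \<beta>) * g (exp \<beta>))) \<longlongrightarrow> c * J + 0 - C R) at_top"
    by (rule Lim_transform_eventually)
  then have "2 * pi * \<i> * (exp (- s * \<beta>) * g (exp \<beta>)) = c * J + 0 - C R"
    using tendsto_unique[OF trivial_limit_at_top_linorder tendsto_const] by blast
  then have "c * J - C R = 2 * pi * \<i> * (exp (- s * \<beta>) * g (exp \<beta>))" by simp
  moreover have "keyhole f \<Psi> s R = (c * J - C R) / (2 * pi * \<i>)"
    by (simp add: keyhole_def c_def J_def C_def field_simps)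
  ultimately show "keyhole f \<Psi> s R = exp (- s * \<beta>) * g (exp \<beta>)"
    by (simp only:) simp
qed

section \<open>Auxiliary facts on factors, powers and series\<close>

text \<open>
  The derivative of the exponent is a geometric sum, and multiplying it by \<open>1 - w\<close> cancels all
  terms except \<open>w\<^sup>p\<close>.
\<close>
lemma weierstrass_factor_has_field_derivative:
  "(weierstrass_factor p has_field_derivative - (w ^ p * exp (\<Sum>k=1..p. w ^ k / of_nat k))) (at w)"
proof -
  define S where "S = (\<lambda>w::complex. \<Sum>k=1..p. w ^ k / of_nat k)"
  have "(S has_field_derivative (\<Sum>k=1..p. w ^ (k - 1))) (at w)"
    unfolding S_def by (auto intro!: derivative_eq_intros sum.cong)
  then have "((\<lambda>w. (1 - w) * exp (S w)) has_field_derivative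
      - exp (S w) + (1 - w) * ((\<Sum>k=1..p. w ^ (k - 1)) * exp (S w))) (at w)"
    by (auto intro!: derivative_eq_intros)
  moreover have "(1 - w) * (\<Sum>k=1..p. w ^ (k - 1)) = 1 - w ^ p"
  proof (induction p)
    case (Suc p)
    have "(1 - w) * (\<Sum>k=1..Suc p. w ^ (k - 1)) = (1 - w) * (\<Sum>k=1..p. w ^ (k - 1)) + (1 - w) * w ^ p"
      by (simp add: distrib_left)
    also have "\<dots> = 1 - w ^ Suc p" unfolding Suc.IH by (simp add: left_diff_distrib)
    finally show ?case .
  qed simp
  then have "- exp (S w) + (1 - w) * ((\<Sum>k=1..p. w ^ (k - 1)) * exp (S w)) = - (w ^ p * exp (S w))"
    by (simp flip: mult.assoc) (simp add: algebra_simps)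
  ultimately show ?thesis
    by (simp add: weierstrass_factor_def[abs_def] S_def)
qed

lemma weierstrass_factor_logderiv:
  assumes "b \<noteq> 0" "z \<noteq> b"
  shows "deriv (\<lambda>z. weierstrass_factor p (z / b)) z / weierstrass_factor p (z / b) =
           z ^ p / (b ^ p * (z - b))"
proof -
  define E where "E = exp (\<Sum>k=1..p. (z / b) ^ k / of_nat k)"
  have "((\<lambda>z. weierstrass_factor p (z / b)) has_field_derivative - ((z / b) ^ p * E) * (1 / b)) (at z)"
    unfolding E_def
    by (rule DERIV_chain2[OF weierstrass_factor_has_field_derivative])
       (use assms in \<open>auto intro!: derivative_eq_intros\<close>)
  then have "deriv (\<lambda>z. weierstrass_factor p (z / b)) z = - ((z / b) ^ p * E) * (1 / b)"
    by (rule DERIV_imp_deriv)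
  moreover have "weierstrass_factor p (z / b) = (1 - z / b) * E"
    by (simp add: weierstrass_factor_def E_def)
  moreover have "1 - z / b = - (z - b) / b" using assms by (simp add: field_simps)
  moreover have "E \<noteq> 0" "z - b \<noteq> 0" using assms by (simp_all add: E_def)
  ultimately show ?thesis using assms(1)
    by (simp only: power_divide) (simp add: divide_simps, simp add: algebra_simps)
qed

text \<open>
  Interpolation between the trivial bounds \<open>t \<le> t + r\<close> and \<open>r \<le> t + r\<close>. It splits
  \<open>1 / (t + r)\<close> into a power of \<open>t\<close> to be integrated and a power of \<open>r\<close> to be summed.
\<close>
lemma powr_interpolate_le_add:
  fixes t r \<beta> :: real
  assumes "t > 0" "r > 0" "0 \<le> \<beta>" "\<beta> \<le> 1"
  shows "t powr (1 - \<beta>) * r powr \<beta> \<le> t + r"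
proof -
  have "t powr (1 - \<beta>) * r powr \<beta> \<le> (t + r) powr (1 - \<beta>) * (t + r) powr \<beta>"
    using assms by (intro mult_mono powr_mono2) auto
  also have "\<dots> = t + r" using assms by (simp flip: powr_add)
  finally show ?thesis .
qed

lemma poly_norm_le_powr:
  fixes P :: "complex poly" and q R :: real
  assumes "P = 0 \<or> real (degree P) \<le> q - 1" "R > 0"
  obtains K where "\<And>z. norm z \<ge> R \<Longrightarrow> norm (poly P z) \<le> K * norm z powr (q - 1)"
proof (cases "P = 0")
  case True
  with that[of 0] show ?thesis by simp
next
  case False
  with assms have deg: "real (degree P) \<le> q - 1" by simp
  show ?thesis
  proof (rule that[of "\<Sum>i\<le>degree P. norm (coeff P i) * R powr (real i - (q - 1))"])
    fix z :: complex assume z: "norm z \<ge> R"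
    have "norm (poly P z) \<le> (\<Sum>i\<le>degree P. norm (coeff P i * z ^ i))"
      unfolding poly_altdef by (rule norm_sum)
    also have "\<dots> \<le> (\<Sum>i\<le>degree P. norm (coeff P i) * R powr (real i - (q - 1)) * norm z powr (q - 1))"
    proof (rule sum_mono)
      fix i assume "i \<in> {..degree P}"
      with deg have i: "real i - (q - 1) \<le> 0" by auto
      have "norm z > 0" using z assms(2) by linarith
      then have "norm z ^ i = norm z powr (real i - (q - 1)) * norm z powr (q - 1)"
        by (subst powr_realpow[symmetric]) (simp_all flip: powr_add)
      also have "\<dots> \<le> R powr (real i - (q - 1)) * norm z powr (q - 1)"
        using z assms(2) i by (intro mult_right_mono powr_mono2') auto
      finally show "norm (coeff P i * z ^ i) \<le>
          norm (coeff P i) * R powr (real i - (q - 1)) * norm z powr (q - 1)"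
        by (simp add: norm_mult norm_power mult.assoc mult_left_mono)
    qed
    finally show "norm (poly P z) \<le>
        (\<Sum>i\<le>degree P. norm (coeff P i) * R powr (real i - (q - 1))) * norm z powr (q - 1)"
      by (simp add: sum_distrib_right)
  qed
qed

lemma set_integral_sums_dominated:
  fixes f :: "nat \<Rightarrow> real \<Rightarrow> complex"
  assumes f: "\<And>n. set_integrable lborel A (f n)" and w: "set_integrable lborel A w"
    and bound: "\<And>n x. x \<in> A \<Longrightarrow> norm (f n x) \<le> B n * w x"
    and B: "summable B" and g: "\<And>x. x \<in> A \<Longrightarrow> (\<lambda>n. f n x) sums g x"
  shows "set_integrable lborel A g"
    and "(\<lambda>n. LINT x:A|lborel. f n x) sums (LINT x:A|lborel. g x)"
proof -
  define F where "F = (\<lambda>n x. indicat_real A x *\<^sub>R f n x)"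
  have F: "integrable lborel (F n)" for n using f[of n] by (simp add: F_def set_integrable_def)
  have F_le: "norm (F n x) \<le> B n * (indicat_real A x *\<^sub>R w x)" for n x
    using bound[of x n] by (auto simp: F_def indicator_def)
  have w': "integrable lborel (\<lambda>x. indicat_real A x *\<^sub>R w x)" using w by (simp add: set_integrable_def)
  have 1: "AE x in lborel. summable (\<lambda>n. norm (F n x))"
    using F_le by (intro AE_I2 summable_comparison_test'[OF summable_mult2[OF B]]) auto
  have 2: "summable (\<lambda>n. \<integral>x. norm (F n x) \<partial>lborel)"
  proof (rule summable_comparison_test')
    show "summable (\<lambda>n. B n * (\<integral>x. indicat_real A x *\<^sub>R w x \<partial>lborel))"
      by (rule summable_mult2[OF B])
    show "norm (\<integral>x. norm (F n x) \<partial>lborel) \<le> B n * (\<integral>x. indicat_real A x *\<^sub>R w x \<partial>lborel)" for n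
    proof -
      have "(\<integral>x. norm (F n x) \<partial>lborel) \<le> (\<integral>x. B n * (indicat_real A x *\<^sub>R w x) \<partial>lborel)"
        using F F_le w' by (intro integral_mono) auto
      then show ?thesis by simp
    qed
  qed
  have eq: "(\<Sum>n. F n x) = indicat_real A x *\<^sub>R g x" for x
    using g[of x] by (auto simp: F_def indicator_def sums_iff)
  show "set_integrable lborel A g"
    using integrable_suminf[OF F 1 2] unfolding eq by (simp add: set_integrable_def)
  show "(\<lambda>n. LINT x:A|lborel. f n x) sums (LINT x:A|lborel. g x)"
    using sums_integral[OF F 1 2] unfolding eq by (simp add: set_lebesgue_integral_def F_def)
qed

section \<open>Sequences avoiding a sector and their Hadamard products\<close>

lemma exponent_of_convergence_lessD:
  assumes "exponent_of_convergence a < ereal \<tau>" and "filterlim (\<lambda>n. norm (a n)) at_top sequentially"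
  shows "eventually (\<lambda>n. real n < norm (a n) powr \<tau>) sequentially"
proof -
  have "eventually (\<lambda>n. ereal (ln (real n) / ln (norm (a n))) < ereal \<tau>) sequentially"
    using assms(1) unfolding exponent_of_convergence_def by (rule Limsup_lessD)
  moreover have "eventually (\<lambda>n. 1 < norm (a n)) sequentially"
    using assms(2) by (simp add: filterlim_at_top_dense)
  ultimately show ?thesis
    using eventually_gt_at_top[of 0]
  proof eventually_elim
    case (elim n)
    then have "ln (norm (a n)) > 0" by (intro ln_gt_zero) auto
    with elim have "ln (real n) < \<tau> * ln (norm (a n))" by (simp add: pos_divide_less_eq)
    then have "exp (ln (real n)) < exp (\<tau> * ln (norm (a n)))" by (simp only: exp_less_mono)
    moreover have "a n \<noteq> 0" using elim by auto
    ultimately show ?case using elim by (simp add: powr_def)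
  qed
qed

text \<open>The standing assumptions on the sequence, with the half-width \<open>\<epsilon>\<close> of the sector made explicit.\<close>
locale sectorial_sequence =
  fixes a :: "nat \<Rightarrow> complex" and \<alpha> \<Psi> \<epsilon> :: real
  assumes pos: "0 < norm (a 1)"
    and mono: "\<And>m n. 1 \<le> m \<Longrightarrow> m \<le> n \<Longrightarrow> norm (a m) \<le> norm (a n)"
    and unbounded: "filterlim (\<lambda>n. norm (a n)) at_top sequentially"
    and exponent: "exponent_of_convergence a = ereal \<alpha>"
    and sector: "\<And>n. n \<ge> 1 \<Longrightarrow> a n \<in> sector_complement \<Psi> \<epsilon>" "\<epsilon> > 0"
begin

lemma norm_ge: "norm (a 1) \<le> norm (a (Suc n))"
  using mono[of 1 "Suc n"] by simp

lemma nonzero: "a (Suc n) \<noteq> 0"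
  using norm_ge[of n] pos by auto

lemma exponent_nonneg: "\<alpha> \<ge> 0"
proof (rule ccontr)
  assume "\<not> \<alpha> \<ge> 0"
  then have "eventually (\<lambda>n. real n < norm (a n) powr 0) sequentially"
    by (intro exponent_of_convergence_lessD unbounded) (simp add: exponent)
  then have "eventually (\<lambda>n::nat. False) sequentially"
    using eventually_gt_at_top[of 1]
    by eventually_elim (auto split: if_splits simp: powr_zero_eq_one)
  then show False by simp
qed

text \<open>
  For \<open>\<alpha> < \<rho> < \<tau>\<close> the definition of \<open>\<alpha>\<close> gives \<open>n < |a\<^sub>n|\<^sup>\<rho>\<close> for large \<open>n\<close>, so the terms are
  dominated by \<open>n\<close> to the power \<open>- \<tau> / \<rho> < - 1\<close>.
\<close>
lemma summable_norm_powr: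
  assumes "\<tau> > \<alpha>"
  shows "summable (\<lambda>n. norm (a (Suc n)) powr (- \<tau>))"
proof -
  obtain \<rho> where \<rho>: "\<alpha> < \<rho>" "\<rho> < \<tau>" using assms dense by blast
  have \<rho>0: "\<rho> > 0" using \<rho> exponent_nonneg by linarith
  have ev: "eventually (\<lambda>n. real n < norm (a n) powr \<rho>) sequentially"
    using \<rho> by (intro exponent_of_convergence_lessD unbounded) (simp add: exponent)
  have "summable (\<lambda>n. norm (a n) powr (- \<tau>))"
  proof (rule summable_comparison_test_ev)
    show "summable (\<lambda>n. real n powr (- \<tau> / \<rho>))"
      using \<rho> \<rho>0 by (simp add: summable_real_powr_iff pos_divide_less_eq)
    show "\<forall>\<^sub>F n in sequentially. norm (norm (a n) powr - \<tau>) \<le> real n powr (- \<tau> / \<rho>)"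
      using ev eventually_gt_at_top[of 0]
    proof eventually_elim
      case (elim n)
      have "norm (a n) powr (- \<tau>) = (norm (a n) powr \<rho>) powr (- \<tau> / \<rho>)"
        using \<rho>0 by (simp add: powr_powr)
      also have "\<dots> \<le> real n powr (- \<tau> / \<rho>)"
        using elim \<rho> \<rho>0 by (intro powr_mono2') auto
      finally show ?case by simp
    qed
  qed
  then show ?thesis by (subst summable_Suc_iff)
qed

definition p :: nat where "p = nat \<lfloor>\<alpha>\<rfloor>"

lemma p_bounds: "real p \<le> \<alpha>" "\<alpha> < real p + 1"
  using exponent_nonneg by (simp_all add: p_def)

text \<open>
  The logarithmic derivative of one factor of the Hadamard product: a simple pole at \<open>a\<^sub>n\<close> with
  residue \<open>1\<close>, minus its Taylor polynomial of degree less than \<open>p\<close> at the origin.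
\<close>
definition pole_term :: "nat \<Rightarrow> complex \<Rightarrow> complex" where
  "pole_term n z = z ^ p / (a (Suc n) ^ p * (z - a (Suc n)))"

definition H :: "complex \<Rightarrow> complex" where "H = hadamard_product a (p + 1)"

definition logderiv_H :: "complex \<Rightarrow> complex" where "logderiv_H z = deriv H z / H z"

sublocale weierstrass: weierstrass_product "\<lambda>n. a (Suc n)" "\<lambda>_. p"
proof
  show "filterlim (\<lambda>n. a (Suc n)) at_infinity at_top"
    using unbounded by (subst filterlim_at_infinity_conv_norm_at_top, subst filterlim_sequentially_Suc)
  show "summable (\<lambda>n. (r / norm (a (Suc n))) ^ Suc p)" if "r > 0" for r
  proof -
    have "summable (\<lambda>n. r ^ Suc p * norm (a (Suc n)) powr (- (real p + 1)))"
      by (intro summable_mult summable_norm_powr p_bounds)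
    moreover have "norm (a (Suc n)) powr (- (real p + 1)) = 1 / norm (a (Suc n)) ^ Suc p" for n
      using nonzero[of n] powr_realpow[of "norm (a (Suc n))" "Suc p"] 
      by (simp only: powr_minus_divide) (simp add: add.commute)
    ultimately show ?thesis by (simp only: power_divide) simp
  qed
qed (rule nonzero)

lemma H_eq: "H = weierstrass.f"
  by (simp add: H_def weierstrass.f_def[abs_def] hadamard_product_def[abs_def])

lemma H_holomorphic: "H holomorphic_on A"
  unfolding H_eq by (rule weierstrass.holomorphic)

lemma H_eq_0_iff: "H z = 0 \<longleftrightarrow> z \<in> range (\<lambda>n. a (Suc n))"
  unfolding H_eq by (rule weierstrass.zero)

lemma pole_term_sums:
  assumes "H z \<noteq> 0"
  shows "(\<lambda>n. pole_term n z) sums logderiv_H z"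
proof -
  define r where "r = norm z + 1"
  have r: "r > 0" by (simp add: r_def add_nonneg_pos)
  have "uniform_limit (ball 0 r) (\<lambda>N z. \<Prod>n<N. weierstrass_factor p (z / a (Suc n))) H sequentially"
    using weierstrass.uniform_limit[OF r] unfolding H_eq
    by (rule uniform_limit_on_subset) auto
  then have "(\<lambda>n. deriv (\<lambda>z. weierstrass_factor p (z / a (Suc n))) z / weierstrass_factor p (z / a (Suc n)))
      sums (deriv H z / H z)"
    by (rule logderiv_prodinf_complex_uniform_limit)
       (use assms nonzero in \<open>auto simp: r_def intro!: holomorphic_intros\<close>)
  moreover have "z \<noteq> a (Suc n)" for n using assms by (auto simp: H_eq_0_iff)
  ultimately show ?thesis
    by (simp add: weierstrass_factor_logderiv nonzero pole_term_def logderiv_H_def)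
qed

lemma H_nonzero_disc: "norm z < norm (a 1) \<Longrightarrow> H z \<noteq> 0"
  using norm_ge unfolding H_eq_0_iff by (metis imageE leD)

lemma dist_ray:
  obtains c where "c > 0"
    "\<And>n t. t \<ge> 0 \<Longrightarrow> c * (t + norm (a (Suc n))) \<le> norm (of_real t * cis \<Psi> - a (Suc n))"
proof (rule sector_complement_dist[OF sector(2), of \<Psi>])
  fix c assume "c > 0" and
    "\<And>z t. z \<in> sector_complement \<Psi> \<epsilon> \<Longrightarrow> 0 \<le> t \<Longrightarrow> c * (t + cmod z) \<le> cmod (of_real t * cis \<Psi> - z)"
  with that[of c] sector(1) show ?thesis by simp
qed

lemma H_nonzero_ray:
  assumes "t \<ge> 0"
  shows "H (of_real t * cis \<Psi>) \<noteq> 0"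
proof
  assume "H (of_real t * cis \<Psi>) = 0"
  then obtain n where n: "of_real t * cis \<Psi> = a (Suc n)" by (auto simp: H_eq_0_iff)
  obtain c where "c > 0" "c * (t + norm (a (Suc n))) \<le> norm (of_real t * cis \<Psi> - a (Suc n))"
    using dist_ray assms by metis
  moreover have "t + norm (a (Suc n)) > 0" using nonzero[of n] assms by (simp add: add_nonneg_pos)
  then have "c * (t + norm (a (Suc n))) > 0" using \<open>c > 0\<close> by simp
  ultimately show False using n by simp
qed

text \<open>
  The exponent \<open>\<tau>\<close> is free between \<open>p\<close> and \<open>p + 1\<close>: any \<open>\<tau> > \<alpha>\<close> makes the bound summable in \<open>n\<close>,
  and any \<open>\<tau> < Re s\<close> makes it integrable against \<open>t\<^sup>-\<^sup>s\<close> at infinity.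
\<close>
lemma pole_term_ray_bound:
  obtains C where "C > 0"
    "\<And>n t \<tau>. t > 0 \<Longrightarrow> real p \<le> \<tau> \<Longrightarrow> \<tau> \<le> real p + 1 \<Longrightarrow>
       norm (pole_term n (of_real t * cis \<Psi>)) \<le> C * norm (a (Suc n)) powr (- \<tau>) * t powr (\<tau> - 1)"
proof -
  obtain c where c: "c > 0"
    "\<And>n t. t \<ge> 0 \<Longrightarrow> c * (t + norm (a (Suc n))) \<le> norm (of_real t * cis \<Psi> - a (Suc n))"
    using dist_ray by metis
  show ?thesis
  proof (rule that[of "1 / c"])
    fix n t \<tau> assume t: "(t::real) > 0" and \<tau>: "real p \<le> \<tau>" "\<tau> \<le> real p + 1"
    define r where "r = norm (a (Suc n))"
    have r: "r > 0" using nonzero[of n] by (simp add: r_def)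
    have "t powr (1 - (\<tau> - p)) * r powr (\<tau> - p) \<le> t + r"
      using t r \<tau> by (intro powr_interpolate_le_add) auto
    then have "c * (t powr (1 - (\<tau> - p)) * r powr (\<tau> - p)) \<le> c * (t + r)"
      using c(1) by (intro mult_left_mono) auto
    also have "\<dots> \<le> norm (of_real t * cis \<Psi> - a (Suc n))"
      using c(2)[of t n] t by (simp add: r_def)
    finally have le: "c * (t powr (1 - (\<tau> - p)) * r powr (\<tau> - p)) \<le> norm (of_real t * cis \<Psi> - a (Suc n))" .
    have "norm (pole_term n (of_real t * cis \<Psi>)) = t ^ p / (r ^ p * norm (of_real t * cis \<Psi> - a (Suc n)))"
      using t by (simp add: pole_term_def norm_mult norm_divide norm_power r_def)
    also have "\<dots> \<le> t ^ p / (r ^ p * (c * (t powr (1 - (\<tau> - p)) * r powr (\<tau> - p))))"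
    proof -
      have "0 < c * (t powr (1 - (\<tau> - p)) * r powr (\<tau> - p))" using t r c(1) by simp
      moreover from this le have "0 < norm (of_real t * cis \<Psi> - a (Suc n))" by linarith
      ultimately show ?thesis
        using t r le c(1) by (intro divide_left_mono mult_left_mono mult_pos_pos) auto
    qed
    also have "\<dots> = 1 / c * r powr (- \<tau>) * t powr (\<tau> - 1)"
      using t r c(1) by (simp add: powr_diff powr_minus powr_realpow[symmetric] divide_simps)
    finally show "norm (pole_term n (of_real t * cis \<Psi>)) \<le>
        1 / c * norm (a (Suc n)) powr (- \<tau>) * t powr (\<tau> - 1)" by (simp add: r_def)
  qed (use c in auto)
qed

text \<open>
  Near the origin the exponent \<open>p + 1 > \<alpha>\<close> is available, and the zero of order \<open>p\<close> of every term
  survives in the sum.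
\<close>
lemma pole_term_disc_bound:
  assumes "norm z \<le> R" "R < norm (a 1)"
  shows "norm (pole_term n z) \<le>
    norm (a 1) / (norm (a 1) - R) * norm (a (Suc n)) powr (- (real p + 1)) * norm z ^ p"
proof -
  define r where "r = norm (a (Suc n))"
  have r: "norm (a 1) \<le> r" "r > 0" using norm_ge[of n] nonzero[of n] by (auto simp: r_def)
  have R: "R \<ge> 0" using assms(1) norm_ge_zero order_trans by blast
  have "R * norm (a 1) \<le> R * r" using R r by (intro mult_left_mono)
  then have "(norm (a 1) - R) / norm (a 1) * r \<le> r - R"
    using pos by (simp add: field_simps)
  also have "\<dots> \<le> norm (z - a (Suc n))"
    using assms(1) norm_triangle_ineq3[of z "a (Suc n)"] by (simp add: r_def)
  finally have le: "(norm (a 1) - R) / norm (a 1) * r \<le> norm (z - a (Suc n))" .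
  have "norm (pole_term n z) = norm z ^ p / (r ^ p * norm (z - a (Suc n)))"
    by (simp add: pole_term_def norm_mult norm_divide norm_power r_def)
  also have "\<dots> \<le> norm z ^ p / (r ^ p * ((norm (a 1) - R) / norm (a 1) * r))"
  proof -
    have "0 < (norm (a 1) - R) / norm (a 1)"
      using assms(2) pos by (intro divide_pos_pos) auto
    moreover from mult_pos_pos[OF this r(2)] le have "0 < norm (z - a (Suc n))" by linarith
    ultimately
    show ?thesis
      using r le by (intro divide_left_mono mult_left_mono mult_pos_pos) auto
  qed
  also have "\<dots> = norm (a 1) / (norm (a 1) - R) * (1 / r ^ Suc p) * norm z ^ p"
    using r pos by (simp add: mult_ac)
  also have "1 / r ^ Suc p = r powr (- (real p + 1))"
    using r powr_realpow[of r "Suc p"]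
    by (simp only: powr_minus_divide) (simp add: add.commute)
  finally show ?thesis by (simp add: r_def)
qed

section \<open>Keyhole integrals of logarithmic derivatives\<close>

text \<open>
  Each zero contributes its own term of the \<open>\<zeta>\<close>-series. The term has growth exactly
  \<open>|z|\<^sup>p\<^sup>-\<^sup>1\<close> at infinity, but it is treated with an exponent \<open>\<tau> \<ge> p\<close> for which a bound along
  the whole ray is at hand.
\<close>
lemma keyhole_pole_term:
  assumes R: "0 < R" "R < norm (a 1)" and \<tau>: "real p \<le> \<tau>" "\<tau> \<le> real p + 1" "\<tau> < Re s"
  shows "set_integrable lborel {R<..} (ray_pullback (pole_term n) \<Psi> s)"
    and "keyhole (pole_term n) \<Psi> s R = branch_powr \<Psi> (a (Suc n)) (- s)"
proof -
  obtain \<beta> where \<beta>: "exp \<beta> = a (Suc n)" "\<Psi> - 2 * pi < Im \<beta>" "Im \<beta> < \<Psi>"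
    "\<And>w. branch_powr \<Psi> (a (Suc n)) w = exp (w * \<beta>)"
    using sector_complement_branch_log[OF sector(1) sector(2) nonzero, of n] by auto
  obtain C where C: "C > 0"
    "\<And>n t \<tau>. t > 0 \<Longrightarrow> real p \<le> \<tau> \<Longrightarrow> \<tau> \<le> real p + 1 \<Longrightarrow>
       norm (pole_term n (of_real t * cis \<Psi>)) \<le> C * norm (a (Suc n)) powr (- \<tau>) * t powr (\<tau> - 1)"
    using pole_term_ray_bound by metis
  define g where "g = (\<lambda>z. z ^ p / a (Suc n) ^ p)"
  have g: "g holomorphic_on UNIV"
    unfolding g_def using nonzero by (intro holomorphic_intros) auto
  have eq: "pole_term n = (\<lambda>z. g z / (z - exp \<beta>))"
    by (simp add: pole_term_def[abs_def] g_def \<beta>(1))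
  have R': "R < norm (exp \<beta>)" using R norm_ge[of n] \<beta>(1) by simp
  define r where "r = norm (a (Suc n))"
  have r: "r > 0" using nonzero[of n] by (simp add: r_def)
  have ray: "norm (g (of_real t * cis \<Psi>) / (of_real t * cis \<Psi> - exp \<beta>)) \<le> C * r powr (- \<tau>) * t powr (\<tau> - 1)"
    if "t \<ge> R" for t
    using C(2)[of t \<tau> n] that R \<tau> by (simp add: eq r_def)
  have far: "norm (g z / (z - exp \<beta>)) \<le> 2 / r ^ p * norm z powr (\<tau> - 1)"
    if z: "norm z \<ge> max 1 (2 * r)" for z
  proof -
    have z': "norm z \<ge> 1" "norm z \<ge> 2 * r" "norm z > 0" using z by auto
    have "norm z / 2 \<le> norm z - r" using z' by linarith
    also have "\<dots> \<le> norm (z - a (Suc n))" unfolding r_def by (rule norm_triangle_ineq2)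
    finally have le: "norm z / 2 \<le> norm (z - a (Suc n))" .
    have "norm (g z / (z - exp \<beta>)) = norm z ^ p / r ^ p / norm (z - a (Suc n))"
      by (simp add: g_def \<beta>(1) norm_mult norm_divide norm_power r_def)
    also have "\<dots> \<le> norm z ^ p / r ^ p / (norm z / 2)"
      using le z' r by (intro frac_le) auto
    also have "\<dots> = 2 / r ^ p * norm z powr (real p - 1)"
      using z' by (simp add: powr_diff powr_realpow)
    also have "\<dots> \<le> 2 / r ^ p * norm z powr (\<tau> - 1)"
      using z' r \<tau> by (intro mult_left_mono powr_mono) auto
    finally show ?thesis .
  qed
  note * = keyhole_pole[OF g \<beta>(2,3) R(1) R' ray far \<tau>(3)]
  show "set_integrable lborel {R<..} (ray_pullback (pole_term n) \<Psi> s)"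
    unfolding eq by (rule *(1))
  have "g (exp \<beta>) = 1" using nonzero[of n] by (simp add: g_def \<beta>(1))
  moreover have "keyhole (pole_term n) \<Psi> s R = exp (- s * \<beta>) * g (exp \<beta>)"
    unfolding eq by (rule *(2))
  ultimately show "keyhole (pole_term n) \<Psi> s R = branch_powr \<Psi> (a (Suc n)) (- s)"
    by (simp add: \<beta>(4))
qed

lemma pole_term_continuous:
  assumes "continuous_on A h" "\<And>x. x \<in> A \<Longrightarrow> h x \<noteq> a (Suc n)"
  shows "continuous_on A (\<lambda>x. pole_term n (h x))"
  unfolding pole_term_def using nonzero[of n] assms(2) by (intro continuous_intros assms(1)) auto

text \<open>
  Summation over the zeros. As \<open>\<alpha> < Re s\<close> and \<open>\<alpha> < p + 1\<close>, there is an exponent \<open>\<tau>\<close> above \<open>\<alpha>\<close> but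
  below \<open>Re s\<close> for which both integrals may be interchanged with the sum. The convergence of the
  \<open>\<zeta>\<close>-series is part of the conclusion.
\<close>
lemma keyhole_logderiv_H:
  assumes R: "0 < R" "R < norm (a 1)" and s: "\<alpha> < Re s"
  shows "set_integrable lborel {R<..} (ray_pullback logderiv_H \<Psi> s)"
    and "circle_pullback logderiv_H s R integrable_on {\<Psi> - 2 * pi..\<Psi>}"
    and "(\<lambda>n. branch_powr \<Psi> (a (Suc n)) (- s)) sums keyhole logderiv_H \<Psi> s R"
proof -
  define \<tau> where "\<tau> = min ((\<alpha> + Re s) / 2) (real p + 1)"
  have \<tau>: "\<alpha> < \<tau>" "\<tau> < Re s" "real p \<le> \<tau>" "\<tau> \<le> real p + 1"
    using s p_bounds by (auto simp: \<tau>_def min_def)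
  obtain C where C: "C > 0"
    "\<And>n t \<tau>. t > 0 \<Longrightarrow> real p \<le> \<tau> \<Longrightarrow> \<tau> \<le> real p + 1 \<Longrightarrow>
       norm (pole_term n (of_real t * cis \<Psi>)) \<le> C * norm (a (Suc n)) powr (- \<tau>) * t powr (\<tau> - 1)"
    using pole_term_ray_bound by metis
  note pole = keyhole_pole_term[OF R \<tau>(3,4,2)]
  have w: "set_integrable lborel {R<..} (\<lambda>t. t powr (\<tau> - 1 - Re s))"
    by (rule set_integrable_subset[OF set_integrable_powr_at_top[OF _ R(1)]]) (use \<tau> in auto)
  have bound: "norm (ray_pullback (pole_term n) \<Psi> s t) \<le>
      C * norm (a (Suc n)) powr (- \<tau>) * t powr (\<tau> - 1 - Re s)" if "t \<in> {R<..}" for n t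
  proof -
    have t: "t > 0" using that R by auto
    have "norm (ray_pullback (pole_term n) \<Psi> s t) \<le>
        t powr (- Re s) * (C * norm (a (Suc n)) powr (- \<tau>) * t powr (\<tau> - 1))"
      unfolding norm_ray_pullback[OF t] by (intro mult_left_mono C(2) t \<tau>) auto
    also have "\<dots> = C * norm (a (Suc n)) powr (- \<tau>) * t powr (\<tau> - 1 - Re s)"
      using powr_add[of t "\<tau> - 1" "- Re s"] by simp
    finally show ?thesis .
  qed
  have sumB: "summable (\<lambda>n. C * norm (a (Suc n)) powr (- \<tau>))"
    by (intro summable_mult summable_norm_powr \<tau>)
  have lim: "(\<lambda>n. ray_pullback (pole_term n) \<Psi> s t) sums ray_pullback logderiv_H \<Psi> s t"
    if "t \<in> {R<..}" for t
    unfolding ray_pullback_def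
    by (intro sums_mult pole_term_sums H_nonzero_ray) (use that R in auto)
  note ray = set_integral_sums_dominated[OF pole(1) w bound sumB lim]
  show "set_integrable lborel {R<..} (ray_pullback logderiv_H \<Psi> s)" by (rule ray(1))

  let ?I = "{\<Psi> - 2 * pi..\<Psi>}"
  have nR: "norm (of_real R * cis \<theta>) = R" for \<theta> using R by (simp add: norm_mult)
  have cint: "set_integrable lborel ?I (circle_pullback (pole_term n) s R)" for n
  proof (rule borel_integrable_atLeastAtMost')
    have "of_real R * cis \<theta> \<noteq> a (Suc n)" for \<theta>
      using nR[of \<theta>] norm_ge[of n] R by auto
    then show "continuous_on ?I (circle_pullback (pole_term n) s R)"
      unfolding circle_pullback_def
      by (intro continuous_intros pole_term_continuous) (auto simp: Complex_eq intro!: continuous_intros)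
  qed
  define D where "D = R powr (1 - Re s) * exp (\<bar>Im s\<bar> * (\<bar>\<Psi>\<bar> + 2 * pi))"
  define B where "B = (\<lambda>n. D * (norm (a 1) / (norm (a 1) - R) *
      norm (a (Suc n)) powr (- (real p + 1)) * R ^ p))"
  have cbound: "norm (circle_pullback (pole_term n) s R \<theta>) \<le> B n * 1" if "\<theta> \<in> ?I" for n \<theta>
  proof -
    have "norm (pole_term n (of_real R * cis \<theta>)) \<le>
        norm (a 1) / (norm (a 1) - R) * norm (a (Suc n)) powr (- (real p + 1)) * R ^ p"
      using pole_term_disc_bound[of "of_real R * cis \<theta>" R n] R by (simp add: nR)
    from norm_circle_pullback_le[where f = "pole_term n", OF R(1) that this] show ?thesis
      by (simp add: B_def D_def)
  qed
  have sumB: "summable B"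
    unfolding B_def by (intro summable_mult summable_mult2 summable_norm_powr p_bounds)
  have clim: "(\<lambda>n. circle_pullback (pole_term n) s R \<theta>) sums circle_pullback logderiv_H s R \<theta>" for \<theta>
    unfolding circle_pullback_def
    by (intro sums_mult pole_term_sums H_nonzero_disc) (use R nR in auto)
  note circ = set_integral_sums_dominated[OF cint _ cbound sumB clim]
  have "set_integrable lborel ?I (\<lambda>_. 1::real)"
    by (intro borel_integrable_atLeastAtMost') auto
  note circ = circ[OF this]
  have circ_int: "set_integrable lborel ?I (circle_pullback logderiv_H s R)"
    by (rule circ(1))
  have circ_sums: "(\<lambda>n. LINT \<theta>:?I|lborel. circle_pullback (pole_term n) s R \<theta>) sums
      (LINT \<theta>:?I|lborel. circle_pullback logderiv_H s R \<theta>)"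
    by (rule circ(2))
  show "circle_pullback logderiv_H s R integrable_on ?I"
    by (rule set_borel_integral_eq_integral(1)[OF circ_int])
  have "(\<lambda>n. keyhole (pole_term n) \<Psi> s R) sums keyhole logderiv_H \<Psi> s R"
    unfolding keyhole_def
    using circ_sums set_borel_integral_eq_integral(2)[OF circ_int] set_borel_integral_eq_integral(2)[OF cint]
    by (intro sums_diff sums_mult ray(2)) simp_all
  then show "(\<lambda>n. branch_powr \<Psi> (a (Suc n)) (- s)) sums keyhole logderiv_H \<Psi> s R"
    by (simp add: pole(2))
qed

text \<open>
  The exponential factor \<open>e\<^sup>\<omega>\<close> adds the polynomial \<open>\<omega>'\<close> to the logarithmic derivative. It has no
  poles, and its degree is less than \<open>p \<le> \<alpha> < Re s\<close>, so that its keyhole integral converges and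
  vanishes.
\<close>
lemma keyhole_pderiv:
  assumes \<omega>: "degree \<omega> \<le> p" and R: "0 < R" "R < norm (a 1)" and s: "\<alpha> < Re s"
  shows "set_integrable lborel {R<..} (ray_pullback (poly (pderiv \<omega>)) \<Psi> s)"
    and "circle_pullback (poly (pderiv \<omega>)) s R integrable_on {\<Psi> - 2 * pi..\<Psi>}"
    and "keyhole (poly (pderiv \<omega>)) \<Psi> s R = 0"
proof -
  let ?P = "poly (pderiv \<omega>)"
  have deg: "pderiv \<omega> = 0 \<or> real (degree (pderiv \<omega>)) \<le> real p - 1"
    using \<omega> by (cases "degree \<omega> = 0") (auto simp: pderiv_eq_0_iff degree_pderiv)
  obtain \<beta> where \<beta>: "exp \<beta> = a 1" "\<Psi> - 2 * pi < Im \<beta>" "Im \<beta> < \<Psi>"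
    using sector_complement_branch_log[OF sector(1) sector(2), of 1] pos by auto
  obtain K where K: "\<And>z. norm z \<ge> R \<Longrightarrow> norm (?P z) \<le> K * norm z powr (real p - 1)"
    using poly_norm_le_powr[OF deg R(1)] by blast
  \<comment> \<open>Any point off the ray and outside the circle would serve as the removable pole.\<close>
  define g where "g = (\<lambda>z. ?P z * (z - exp \<beta>))"
  have g: "g holomorphic_on UNIV" unfolding g_def by (intro holomorphic_intros)
  have eq: "g z / (z - exp \<beta>) = ?P z" if "z \<noteq> exp \<beta>" for z
    using that by (simp add: g_def)
  have ray_ne: "of_real t * cis \<Psi> \<noteq> exp \<beta>" if "t > 0" for t
    using cis_ray_neq_exp[OF \<beta>(2,3) that] .
  have circ_ne: "of_real R * cis \<theta> \<noteq> exp \<beta>" for \<theta>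
  proof
    assume "of_real R * cis \<theta> = exp \<beta>"
    then have "norm (of_real R * cis \<theta>) = norm (a 1)" using \<beta>(1) by simp
    with R show False by (simp add: norm_mult)
  qed
  have far: "norm (g z / (z - exp \<beta>)) \<le> K * norm z powr (real p - 1)" if "R \<le> norm z" for z
  proof (cases "z = exp \<beta>")
    case True
    have "0 \<le> norm (?P z)" by simp
    also have "\<dots> \<le> K * norm z powr (real p - 1)" by (rule K[OF that])
    finally show ?thesis using True by simp
  qed (use K[OF that] eq in simp)
  have ray: "norm (g (of_real t * cis \<Psi>) / (of_real t * cis \<Psi> - exp \<beta>)) \<le> K * t powr (real p - 1)"
    if "R \<le> t" for t
    using far[of "of_real t * cis \<Psi>"] that R by (simp add: norm_mult)
  have "real p < Re s" using s p_bounds by linarith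
  moreover have "R < norm (exp \<beta>)" using R \<beta>(1) by simp
  ultimately have
    int: "set_integrable lborel {R<..} (ray_pullback (\<lambda>z. g z / (z - exp \<beta>)) \<Psi> s)" and
    val: "keyhole (\<lambda>z. g z / (z - exp \<beta>)) \<Psi> s R = exp (- s * \<beta>) * g (exp \<beta>)"
    using keyhole_pole[OF g \<beta>(2,3) R(1) _ ray far] by blast+
  have "ray_pullback (\<lambda>z. g z / (z - exp \<beta>)) \<Psi> s t = ray_pullback ?P \<Psi> s t" if "t \<in> {R<..}" for t
    using ray_ne[of t] that R by (simp add: ray_pullback_def eq)
  then have "set_integrable lborel {R<..} (ray_pullback (\<lambda>z. g z / (z - exp \<beta>)) \<Psi> s) \<longleftrightarrow>
      set_integrable lborel {R<..} (ray_pullback ?P \<Psi> s)"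
    by (rule set_integrable_cong[OF refl refl])
  with int show "set_integrable lborel {R<..} (ray_pullback ?P \<Psi> s)" by simp
  have "keyhole ?P \<Psi> s R = keyhole (\<lambda>z. g z / (z - exp \<beta>)) \<Psi> s R"
    using R by (intro keyhole_cong) (auto simp: eq ray_ne circ_ne)
  then show "keyhole ?P \<Psi> s R = 0" using val by (simp add: g_def)
  show "circle_pullback ?P s R integrable_on {\<Psi> - 2 * pi..\<Psi>}"
    unfolding circle_pullback_def Complex_eq
    by (intro integrable_continuous_interval continuous_intros)
qed

lemma logderiv_exp_poly_H:
  assumes F: "\<And>z. F z = exp (poly \<omega> z) * H z" and "H z \<noteq> 0"
  shows "deriv F z / F z = poly (pderiv \<omega>) z + logderiv_H z"
proof -
  have "(H has_field_derivative deriv H z) (at z)"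
    by (rule holomorphic_derivI[OF H_holomorphic open_UNIV UNIV_I])
  then have "((\<lambda>z. exp (poly \<omega> z) * H z) has_field_derivative
      exp (poly \<omega> z) * (poly (pderiv \<omega>) z * H z + deriv H z)) (at z)"
    by (auto intro!: derivative_eq_intros simp: algebra_simps)
  then have "(F has_field_derivative exp (poly \<omega> z) * (poly (pderiv \<omega>) z * H z + deriv H z)) (at z)"
    by (simp flip: F)
  from DERIV_imp_deriv[OF this] show ?thesis
    using assms(2) by (simp add: F logderiv_H_def field_simps)
qed

lemma keyhole_logderiv_exp_poly_H:
  assumes F: "\<And>z. F z = exp (poly \<omega> z) * H z" and \<omega>: "degree \<omega> \<le> p"
    and R: "0 < R" "R < norm (a 1)" and s: "\<alpha> < Re s"
  shows "set_integrable lborel {R<..} (ray_pullback (\<lambda>z. deriv F z / F z) \<Psi> s)"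
    and "circle_pullback (\<lambda>z. deriv F z / F z) s R integrable_on {\<Psi> - 2 * pi..\<Psi>}"
    and "(\<lambda>n. branch_powr \<Psi> (a (Suc n)) (- s)) sums keyhole (\<lambda>z. deriv F z / F z) \<Psi> s R"
proof -
  let ?P = "poly (pderiv \<omega>)" and ?L = "\<lambda>z. deriv F z / F z"
  note P = keyhole_pderiv[OF \<omega> R s] and L = keyhole_logderiv_H[OF R s]
  have ray: "?L (of_real t * cis \<Psi>) = ?P (of_real t * cis \<Psi>) + logderiv_H (of_real t * cis \<Psi>)"
    if "t > R" for t
    using that R by (intro logderiv_exp_poly_H[OF F] H_nonzero_ray) auto
  have circ: "?L (of_real R * cis \<theta>) = ?P (of_real R * cis \<theta>) + logderiv_H (of_real R * cis \<theta>)" for \<theta>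
    using R by (intro logderiv_exp_poly_H[OF F] H_nonzero_disc) (auto simp: norm_mult)
  have "ray_pullback ?L \<Psi> s t = ray_pullback ?P \<Psi> s t + ray_pullback logderiv_H \<Psi> s t" if "t \<in> {R<..}" for t
    using ray[of t] that unfolding ray_pullback_def by (simp add: algebra_simps)
  then have "set_integrable lborel {R<..} (ray_pullback ?L \<Psi> s) \<longleftrightarrow>
      set_integrable lborel {R<..} (\<lambda>t. ray_pullback ?P \<Psi> s t + ray_pullback logderiv_H \<Psi> s t)"
    by (rule set_integrable_cong[OF refl refl])
  then show "set_integrable lborel {R<..} (ray_pullback ?L \<Psi> s)"
    using set_integral_add(1)[OF P(1) L(1)] by simp
  have "circle_pullback ?L s R = (\<lambda>\<theta>. circle_pullback ?P s R \<theta> + circle_pullback logderiv_H s R \<theta>)"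
    unfolding circle_pullback_def circ by (simp add: algebra_simps)
  then show "circle_pullback ?L s R integrable_on {\<Psi> - 2 * pi..\<Psi>}"
    using integrable_add[OF P(2) L(2)] by simp
  have "keyhole ?L \<Psi> s R = keyhole (\<lambda>z. ?P z + logderiv_H z) \<Psi> s R"
    by (rule keyhole_cong) (simp_all only: ray circ)
  also have "\<dots> = keyhole logderiv_H \<Psi> s R"
    using keyhole_add[OF P(1) L(1) P(2) L(2)] P(3) by simp
  finally show "(\<lambda>n. branch_powr \<Psi> (a (Suc n)) (- s)) sums keyhole ?L \<Psi> s R"
    using L(3) by simp
qed

lemma logderiv_H_disc_bound:
  obtains K where "K \<ge> 0" "\<And>z. norm z \<le> norm (a 1) / 2 \<Longrightarrow> norm (logderiv_H z) \<le> K * norm z ^ p"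
proof
  define A where "A = (\<Sum>n. 2 * norm (a (Suc n)) powr (- (real p + 1)))"
  have sm: "summable (\<lambda>n. 2 * norm (a (Suc n)) powr (- (real p + 1)))"
    by (intro summable_mult summable_norm_powr p_bounds)
  show "A \<ge> 0" unfolding A_def by (intro suminf_nonneg sm) auto
  show "norm (logderiv_H z) \<le> A * norm z ^ p" if z: "norm z \<le> norm (a 1) / 2" for z
  proof -
    have "norm z < norm (a 1)" using z pos by linarith
    then have "logderiv_H z = (\<Sum>n. pole_term n z)"
      using pole_term_sums[OF H_nonzero_disc] by (simp add: sums_iff)
    also have "norm \<dots> \<le> (\<Sum>n. 2 * norm (a (Suc n)) powr (- (real p + 1)) * norm z ^ p)"
    proof (rule norm_suminf_le)
      show "norm (pole_term n z) \<le> 2 * norm (a (Suc n)) powr (- (real p + 1)) * norm z ^ p" for n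
        using pole_term_disc_bound[OF z, of n] pos by simp
      show "summable (\<lambda>n. 2 * norm (a (Suc n)) powr (- (real p + 1)) * norm z ^ p)"
        by (intro summable_mult2 sm)
    qed
    also have "\<dots> = A * norm z ^ p" unfolding A_def by (rule suminf_mult2[OF sm, symmetric])
    finally show ?thesis .
  qed
qed

text \<open>
  The value of the keyhole integral is the same for all small \<open>R\<close>. Near the origin the logarithmic
  derivative is of order \<open>|z|\<^sup>p\<close>; hence for \<open>Re s < p + 1\<close> the circle shrinks to nothing as
  \<open>R \<rightarrow> 0\<close>, and the ray integral extends down to \<open>0\<close>.
\<close>
lemma zeta_integral_logderiv_H:
  assumes s: "\<alpha> < Re s" "Re s < real p + 1"
  shows "set_integrable lborel {0<..} (ray_pullback logderiv_H \<Psi> s)"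
    and "zeta_seq a \<Psi> s = exp (\<i> * s * of_real (pi - \<Psi>)) * (sin (of_real pi * s) / of_real pi) *
           (LINT t:{0<..}|lborel. ray_pullback logderiv_H \<Psi> s t)"
proof -
  define r where "r = norm (a 1) / 2"
  have r: "r > 0" "r < norm (a 1)" using pos by (auto simp: r_def)
  obtain K where K: "K \<ge> 0" "\<And>z. norm z \<le> r \<Longrightarrow> norm (logderiv_H z) \<le> K * norm z ^ p"
    unfolding r_def using logderiv_H_disc_bound by metis
  let ?f = "ray_pullback logderiv_H \<Psi> s"
  have near: "set_integrable lborel {0<..r} ?f"
  proof (rule set_integrable_bound)
    show "set_integrable lborel {0<..r} (\<lambda>t. K * t powr (real p - Re s))"
      using s r by (intro set_integrable_mult_right set_integrable_powr_at_0) auto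
    have along_ray: "continuous_on {0<..r} (\<lambda>t. G (of_real t * cis \<Psi>))" if "G holomorphic_on UNIV" for G
      by (rule continuous_on_compose2[OF holomorphic_on_imp_continuous_on[OF that]])
         (auto intro!: continuous_intros)
    have "deriv H holomorphic_on UNIV" by (intro holomorphic_deriv H_holomorphic) auto
    then have "continuous_on {0<..r} ?f"
      unfolding ray_pullback_def logderiv_H_def
      by (intro continuous_intros along_ray H_holomorphic)
         (auto simp: complex_nonpos_Reals_iff H_nonzero_ray)
    then show "set_borel_measurable lborel {0<..r} ?f"
      unfolding set_borel_measurable_def
      using borel_measurable_continuous_on_indicator[of "{0<..r}"] by auto
    have "norm (?f t) \<le> norm (K * t powr (real p - Re s))" if t: "t \<in> {0<..r}" for t
    proof -
      have "norm (?f t) \<le> t powr (- Re s) * (K * t ^ p)"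
        using t K(2)[of "of_real t * cis \<Psi>"]
        by (subst norm_ray_pullback) (auto simp: norm_mult intro!: mult_left_mono)
      also have "\<dots> = K * t powr (real p - Re s)"
        using t powr_add[of t "real p" "- Re s"] powr_realpow[of t p] by simp
      finally show ?thesis using K(1) by simp
    qed
    then show "AE t in lborel. t \<in> {0<..r} \<longrightarrow> norm (?f t) \<le> norm (K * t powr (real p - Re s))"
      by simp
  qed
  have far: "set_integrable lborel {r<..} ?f" by (rule keyhole_logderiv_H(1)[OF r s(1)])
  have "{0<..} = {0<..r} \<union> {r<..}" using r by auto
  then show int: "set_integrable lborel {0<..} ?f"
    using set_integrable_Un[OF near far] by simp
  define c where "c = exp (\<i> * s * of_real (pi - \<Psi>)) * (sin (of_real pi * s) / of_real pi)"
  define C where "C = (\<lambda>R. integral {\<Psi> - 2 * pi..\<Psi>} (circle_pullback logderiv_H s R))"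
  have key: "c * ((LINT t:{R..r}|lborel. ?f t) + (LINT t:{r<..}|lborel. ?f t)) - 1 / (2 * of_real pi * \<i>) * C R
      = zeta_seq a \<Psi> s" if R: "R \<in> {0<..<r}" for R
  proof -
    have "set_integrable lborel {R..} ?f" by (rule set_integrable_subset[OF int]) (use R in auto)
    then have "(LINT t:{R<..}|lborel. ?f t) = (LINT t:{R..}|lborel. ?f t)"
      by (rule set_lebesgue_integral_Ici_eq_Ioi[symmetric])
    also have "{R..} = {R..r} \<union> {r<..}" using R by auto
    also have "(LINT t:{R..r} \<union> {r<..}|lborel. ?f t) =
        (LINT t:{R..r}|lborel. ?f t) + (LINT t:{r<..}|lborel. ?f t)"
      by (intro set_integral_Un far set_integrable_subset[OF near]) (use R in auto)
    finally have "(LINT t:{R<..}|lborel. ?f t) =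
        (LINT t:{R..r}|lborel. ?f t) + (LINT t:{r<..}|lborel. ?f t)" .
    moreover have "zeta_seq a \<Psi> s = keyhole logderiv_H \<Psi> s R"
      using keyhole_logderiv_H(3)[OF _ _ s(1), of R] R r by (simp add: zeta_seq_def sums_iff)
    ultimately show ?thesis by (simp add: keyhole_def c_def C_def)
  qed
  have "(C \<longlongrightarrow> 0) (at_right 0)"
  proof (rule Lim_null_comparison)
    define D where "D = 2 * pi * (exp (\<bar>Im s\<bar> * (\<bar>\<Psi>\<bar> + 2 * pi)) * K)"
    have "eventually (\<lambda>R. R \<in> {0<..<r}) (at_right 0)"
      using r by (intro eventually_at_right_real)
    then show "\<forall>\<^sub>F R in at_right 0. norm (C R) \<le> D * R powr (real p + 1 - Re s)"
    proof eventually_elim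
      case (elim R)
      have "norm (C R) \<le> 2 * pi * (R powr (1 - Re s) * exp (\<bar>Im s\<bar> * (\<bar>\<Psi>\<bar> + 2 * pi)) * (K * R ^ p))"
        unfolding C_def
      proof (rule norm_integral_circle_pullback_le)
        show "norm (logderiv_H (of_real R * cis \<theta>)) \<le> K * R ^ p" for \<theta>
          using K(2)[of "of_real R * cis \<theta>"] elim by (simp add: norm_mult)
      qed (use elim K in auto)
      also have "R powr (1 - Re s) * exp (\<bar>Im s\<bar> * (\<bar>\<Psi>\<bar> + 2 * pi)) * (K * R ^ p) =
          exp (\<bar>Im s\<bar> * (\<bar>\<Psi>\<bar> + 2 * pi)) * K * (R powr (1 - Re s) * R powr real p)"
        using elim by (simp add: powr_realpow)
      also have "R powr (1 - Re s) * R powr real p = R powr (real p + 1 - Re s)"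
        unfolding powr_add[symmetric] by (simp add: algebra_simps)
      finally show ?case by (simp add: D_def mult.assoc)
    qed
    have "((\<lambda>R. R powr (real p + 1 - Re s)) \<longlongrightarrow> 0 powr (real p + 1 - Re s)) (at_right 0)"
      using s by (intro tendsto_powr2 tendsto_const tendsto_ident_at) (auto simp: eventually_at_filter)
    then show "((\<lambda>R. D * R powr (real p + 1 - Re s)) \<longlongrightarrow> 0) (at_right 0)"
      using tendsto_mult_right_zero[of _ _ D] s by simp
  qed
  moreover have "((\<lambda>R. LINT t:{R..r}|lborel. ?f t) \<longlongrightarrow> (LINT t:{0<..r}|lborel. ?f t)) (at_right 0)"
    by (intro tendsto_set_lebesgue_integral_at_right near r) auto
  ultimately have "((\<lambda>R. c * ((LINT t:{R..r}|lborel. ?f t) + (LINT t:{r<..}|lborel. ?f t))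
        - 1 / (2 * of_real pi * \<i>) * C R) \<longlongrightarrow>
      c * ((LINT t:{0<..r}|lborel. ?f t) + (LINT t:{r<..}|lborel. ?f t)) - 1 / (2 * of_real pi * \<i>) * 0)
      (at_right 0)"
    by (intro tendsto_intros)
  moreover have "\<forall>\<^sub>F R in at_right 0. c * ((LINT t:{R..r}|lborel. ?f t) + (LINT t:{r<..}|lborel. ?f t))
        - 1 / (2 * of_real pi * \<i>) * C R = zeta_seq a \<Psi> s"
    using eventually_at_right_real[OF r(1)] by eventually_elim (rule key)
  ultimately have "((\<lambda>R::real. zeta_seq a \<Psi> s) \<longlongrightarrow>
      c * ((LINT t:{0<..r}|lborel. ?f t) + (LINT t:{r<..}|lborel. ?f t)) - 1 / (2 * of_real pi * \<i>) * 0)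
      (at_right 0)"
    by (rule Lim_transform_eventually)
  then have "zeta_seq a \<Psi> s = c * ((LINT t:{0<..r}|lborel. ?f t) + (LINT t:{r<..}|lborel. ?f t))"
    using tendsto_unique[OF trivial_limit_at_right_real tendsto_const] by force
  also have "(LINT t:{0<..r}|lborel. ?f t) + (LINT t:{r<..}|lborel. ?f t) = (LINT t:{0<..}|lborel. ?f t)"
    unfolding \<open>{0<..} = {0<..r} \<union> {r<..}\<close> by (rule set_integral_Un[symmetric]) (use near far in auto)
  finally show "zeta_seq a \<Psi> s = exp (\<i> * s * of_real (pi - \<Psi>)) * (sin (of_real pi * s) / of_real pi) *
           (LINT t:{0<..}|lborel. ?f t)"
    by (simp add: c_def)
qed

end

section \<open>The integral representations\<close>

theorem theorem2p6:
  fixes a :: "nat \<Rightarrow> complex" and \<alpha> \<Psi> :: real and F :: "complex \<Rightarrow> complex"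
  assumes pos: "0 < norm (a 1)"
    and mono: "\<And>m n. 1 \<le> m \<Longrightarrow> m \<le> n \<Longrightarrow> norm (a m) \<le> norm (a n)"
    and unbounded: "filterlim (\<lambda>n. norm (a n)) at_top sequentially"
    and exponent: "exponent_of_convergence a = ereal \<alpha>"
    and angle: "\<Psi> \<in> {-pi..<pi}"
    and sector: "\<exists>\<epsilon>>0. \<forall>n\<ge>1. a n \<in> sector_complement \<Psi> \<epsilon>"
    and char: "minimal_characteristic_function a \<alpha> F"
  shows "(\<forall>s. Re s > \<alpha> \<longrightarrow> summable (\<lambda>n. branch_powr \<Psi> (a (Suc n)) (- s))) \<and>
    (\<forall>R s. 0 < R \<longrightarrow> R < norm (a 1) \<longrightarrow> Re s > \<alpha> \<longrightarrow>
       set_integrable lborel {R<..} (ray_integrand F \<Psi> s) \<and>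
       circle_integrand F \<Psi> s contour_integrable_on part_circlepath 0 R (\<Psi> - 2 * pi) \<Psi> \<and>
       zeta_seq a \<Psi> s =
         exp (\<i> * s * of_real (pi - \<Psi>)) * (sin (of_real pi * s) / of_real pi) *
           (LINT t:{R<..}|lborel. ray_integrand F \<Psi> s t)
         - 1 / (2 * of_real pi * \<i>) *
           contour_integral (part_circlepath 0 R (\<Psi> - 2 * pi) \<Psi>) (circle_integrand F \<Psi> s)) \<and>
    (\<alpha> < 1 \<longrightarrow>
       (\<forall>s. \<alpha> < Re s \<longrightarrow> Re s < 1 \<longrightarrow>
          set_integrable lborel {0<..} (ray_integrand F \<Psi> s) \<and>
          zeta_seq a \<Psi> s =
            exp (\<i> * s * of_real (pi - \<Psi>)) * (sin (of_real pi * s) / of_real pi) *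
              (LINT t:{0<..}|lborel. ray_integrand F \<Psi> s t))) \<and>
    (F = hadamard_product a (nat \<lfloor>\<alpha>\<rfloor> + 1) \<longrightarrow>
       (\<forall>s. \<alpha> < Re s \<longrightarrow> Re s < of_int \<lfloor>\<alpha>\<rfloor> + 1 \<longrightarrow>
          set_integrable lborel {0<..} (ray_integrand F \<Psi> s) \<and>
          zeta_seq a \<Psi> s =
            exp (\<i> * s * of_real (pi - \<Psi>)) * (sin (of_real pi * s) / of_real pi) *
              (LINT t:{0<..}|lborel. ray_integrand F \<Psi> s t)))"
proof -
  obtain \<epsilon> where \<epsilon>: "\<epsilon> > 0" "\<And>n. n \<ge> 1 \<Longrightarrow> a n \<in> sector_complement \<Psi> \<epsilon>"
    using sector by blast
  interpret sectorial_sequence a \<alpha> \<Psi> \<epsilon>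
    by unfold_locales (use pos mono unbounded exponent \<epsilon> in auto)
  obtain \<omega> where hol: "F holomorphic_on UNIV" and \<omega>: "degree \<omega> \<le> p"
    and F: "\<And>z. F z = exp (poly \<omega> z) * H z"
    using char unfolding minimal_characteristic_function_def p_def H_def by blast
  have ray_eq: "ray_integrand F \<Psi> s = ray_pullback (\<lambda>z. deriv F z / F z) \<Psi> s" for s
    by (rule ext) (rule ray_integrand_eq[OF hol])
  \<comment> \<open>The two formulas with an integral from \<open>0\<close> are one: when \<open>\<alpha> < 1\<close> the polynomial is constant,
    so in both cases the logarithmic derivative is that of the Hadamard product.\<close>
  have below: "set_integrable lborel {0<..} (ray_integrand F \<Psi> s) \<and>
      zeta_seq a \<Psi> s = exp (\<i> * s * of_real (pi - \<Psi>)) * (sin (of_real pi * s) / of_real pi) *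
        (LINT t:{0<..}|lborel. ray_integrand F \<Psi> s t)"
    if const: "pderiv \<omega>' = 0" "\<And>z. F z = exp (poly \<omega>' z) * H z"
      and s: "\<alpha> < Re s" "Re s < real p + 1" for s \<omega>'
  proof -
    have "ray_pullback (\<lambda>z. deriv F z / F z) \<Psi> s t = ray_pullback logderiv_H \<Psi> s t" if "t \<in> {0<..}" for t
      using logderiv_exp_poly_H[OF const(2), of "of_real t * cis \<Psi>"] H_nonzero_ray[of t] const(1) that
      by (simp add: ray_pullback_def)
    then have eq: "set_integrable lborel {0<..} (ray_pullback (\<lambda>z. deriv F z / F z) \<Psi> s) \<longleftrightarrow>
          set_integrable lborel {0<..} (ray_pullback logderiv_H \<Psi> s)"
        "(LINT t:{0<..}|lborel. ray_pullback (\<lambda>z. deriv F z / F z) \<Psi> s t) =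
          (LINT t:{0<..}|lborel. ray_pullback logderiv_H \<Psi> s t)"
      by (intro set_integrable_cong refl set_lebesgue_integral_cong; simp)+
    show ?thesis
      unfolding ray_eq eq using zeta_integral_logderiv_H[OF s] by blast
  qed
  show ?thesis
  proof (intro conjI allI impI)
    fix s assume s: "\<alpha> < Re s"
    show "summable (\<lambda>n. branch_powr \<Psi> (a (Suc n)) (- s))"
      using keyhole_logderiv_H(3)[of "norm (a 1) / 2" s] pos s by (simp add: sums_iff)
  next
    fix R s assume R: "0 < R" "R < norm (a 1)" and s: "\<alpha> < Re s"
    note key = keyhole_logderiv_exp_poly_H[OF F \<omega> R s]
    show "set_integrable lborel {R<..} (ray_integrand F \<Psi> s)"
      unfolding ray_eq by (rule key(1))
    from key(2) have "(circle_integrand F \<Psi> s has_contour_integral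
        integral {\<Psi> - 2 * pi..\<Psi>} (circle_pullback (\<lambda>z. deriv F z / F z) s R))
        (part_circlepath 0 R (\<Psi> - 2 * pi) \<Psi>)"
      unfolding has_contour_integral_circle_integrand_iff[OF R(1)] by (rule integrable_integral)
    then have circ: "circle_integrand F \<Psi> s contour_integrable_on part_circlepath 0 R (\<Psi> - 2 * pi) \<Psi>"
      "contour_integral (part_circlepath 0 R (\<Psi> - 2 * pi) \<Psi>) (circle_integrand F \<Psi> s) =
       integral {\<Psi> - 2 * pi..\<Psi>} (circle_pullback (\<lambda>z. deriv F z / F z) s R)"
      by (auto simp: contour_integrable_on_def contour_integral_unique)
    show "circle_integrand F \<Psi> s contour_integrable_on part_circlepath 0 R (\<Psi> - 2 * pi) \<Psi>"
      by (rule circ(1))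
    show "zeta_seq a \<Psi> s =
         exp (\<i> * s * of_real (pi - \<Psi>)) * (sin (of_real pi * s) / of_real pi) *
           (LINT t:{R<..}|lborel. ray_integrand F \<Psi> s t)
         - 1 / (2 * of_real pi * \<i>) *
           contour_integral (part_circlepath 0 R (\<Psi> - 2 * pi) \<Psi>) (circle_integrand F \<Psi> s)"
      using sums_unique[OF key(3)] unfolding circ(2) ray_eq zeta_seq_def keyhole_def by simp
  next
    fix s assume "\<alpha> < 1" and s: "\<alpha> < Re s" "Re s < 1"
    then have "p = 0" using p_bounds by linarith
    with \<omega> have "pderiv \<omega> = 0" by (simp add: pderiv_eq_0_iff)
    from below[OF this F s(1)] s(2) \<open>p = 0\<close>
    show "set_integrable lborel {0<..} (ray_integrand F \<Psi> s)"
      "zeta_seq a \<Psi> s = exp (\<i> * s * of_real (pi - \<Psi>)) * (sin (of_real pi * s) / of_real pi) *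
        (LINT t:{0<..}|lborel. ray_integrand F \<Psi> s t)"
      by simp_all
  next
    fix s assume FH: "F = hadamard_product a (nat \<lfloor>\<alpha>\<rfloor> + 1)"
      and s: "\<alpha> < Re s" "Re s < of_int \<lfloor>\<alpha>\<rfloor> + 1"
    have "F z = exp (poly 0 z) * H z" for z using FH by (simp add: H_def p_def)
    moreover have "Re s < real p + 1" using s exponent_nonneg by (simp add: p_def)
    ultimately show "set_integrable lborel {0<..} (ray_integrand F \<Psi> s)"
      "zeta_seq a \<Psi> s = exp (\<i> * s * of_real (pi - \<Psi>)) * (sin (of_real pi * s) / of_real pi) *
        (LINT t:{0<..}|lborel. ray_integrand F \<Psi> s t)"
      using below[of 0 s] s(1) by simp_all
  qed
qed

end
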